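(* Fix $0<\alpha<1$ and $0<p<\infty$. The shift operator $S$ is a strict expansion on $A^p_\alpha$ that is norm attaining, with $$\|S\|_{\alpha,p}^p=1+2(1-\alpha)\int_0^1(1-r^p)(1-r^2)^{\alpha-2}\,r\,dr.$$ Moreover, for $f_0\in A^p_\alpha$ with $\|f_0\|_{\alpha,p}=1$, one has $\|Sf_0\|_{\alpha,p}=\|S\|_{\alpha,p}$ if and only if $f_0$ is a constant function.
   Context: $\mathbb{D}$ is the open unit disc in $\mathbb{C}$. For $f$ analytic in $\mathbb{D}$, $0<p<\infty$ and $0<r<1$, set $M_p^p(r,f)=\int_0^{2\pi}|f(re^{i\theta})|^p\,\frac{d\theta}{2\pi}$; the function $r\mapsto M_p^p(r,f)$ is increasing and differentiable on $(0,1)$. For $0<\alpha,p<\infty$ define $$\|f\|_{\alpha,p}^p=|f(0)|^p+\int_0^1\left(\frac{d}{dr}M_p^p(r,f)\right)(1-r^2)^{\alpha-1}\,dr\in[0,\infty],$$ and let $A^p_\alpha$ be the class of all analytic functions $f$ in $\mathbb{D}$ with $\|f\|_{\alpha,p}<\infty$. The shift operator acts on analytic functions by $Sf(z)=zf(z)$. A map $T\colon A^p_\alpha\to A^p_\alpha$ is a strict expansion on $A^p_\alpha$ if $\|Tf\|_{\alpha,p}>\|f\|_{\alpha,p}$ for every $f\in A^p_\alpha$ with $f\not\equiv0$. Set $$\|T\|_{\alpha,p}=\sup_{f\in A^p_\alpha,\ f\not\equiv0}\frac{\|Tf\|_{\alpha,p}}{\|f\|_{\alpha,p}}.$$ $T$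 is norm attaining on $A^p_\alpha$ if there exists $f_0\in A^p_\alpha$ with $\|f_0\|_{\alpha,p}=1$ such that $\|Tf_0\|_{\alpha,p}=\|T\|_{\alpha,p}$. (In the statement, $S$ is in particular asserted to map $A^p_\alpha$ into itself.) *)

theory Defs
  imports "HOL-Complex_Analysis.Complex_Analysis"
begin

text \<open>
  Functions on the unit disc are total functions on the complex numbers of which only the values
  on \<open>ball 0 1\<close> matter.
\<close>

definition integral_mean :: "real \<Rightarrow> (complex \<Rightarrow> complex) \<Rightarrow> real \<Rightarrow> real" where
  "integral_mean p f r =
     (LBINT \<theta>:{0..2 * pi}. norm (f (of_real r * exp (\<i> * of_real \<theta>))) powr p / (2 * pi))"

text \<open>
  The \<open>p\<close>-th power of the norm, with values in \<open>[0,\<infinity>]\<close>. The embedding \<open>ennreal\<close> truncates negative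
  reals to 0, but for holomorphic \<open>f\<close> the mean is differentiable and increasing in the radius, so
  the integrand is nonnegative.
\<close>

definition weighted_norm_powp :: "real \<Rightarrow> real \<Rightarrow> (complex \<Rightarrow> complex) \<Rightarrow> ennreal" where
  "weighted_norm_powp \<alpha> p f =
     ennreal (norm (f 0) powr p) +
     (\<integral>\<^sup>+ r\<in>{0<..<1}. ennreal (deriv (integral_mean p f) r * (1 - r\<^sup>2) powr (\<alpha> - 1)) \<partial>lborel)"

definition weighted_space :: "real \<Rightarrow> real \<Rightarrow> (complex \<Rightarrow> complex) set" where
  "weighted_space \<alpha> p = {f. f holomorphic_on ball 0 1 \<and> weighted_norm_powp \<alpha> p f < \<infinity>}"

text \<open>Meaningful only on \<open>weighted_space \<alpha> p\<close>: elsewhere \<open>enn2real\<close> may send \<open>\<infinity>\<close> to 0.\<close>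

definition weighted_norm :: "real \<Rightarrow> real \<Rightarrow> (complex \<Rightarrow> complex) \<Rightarrow> real" where
  "weighted_norm \<alpha> p f = enn2real (weighted_norm_powp \<alpha> p f) powr (1 / p)"

definition shift :: "(complex \<Rightarrow> complex) \<Rightarrow> complex \<Rightarrow> complex" where
  "shift f = (\<lambda>z. z * f z)"

definition nonzero_on_disc :: "(complex \<Rightarrow> complex) \<Rightarrow> bool" where
  "nonzero_on_disc f \<longleftrightarrow> (\<exists>z\<in>ball 0 1. f z \<noteq> 0)"

definition strict_expansion ::
  "real \<Rightarrow> real \<Rightarrow> ((complex \<Rightarrow> complex) \<Rightarrow> complex \<Rightarrow> complex) \<Rightarrow> bool" where
  "strict_expansion \<alpha> p T \<longleftrightarrow>
     T ` weighted_space \<alpha> p \<subseteq> weighted_space \<alpha> p \<and>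
     (\<forall>f\<in>weighted_space \<alpha> p. nonzero_on_disc f \<longrightarrow> weighted_norm \<alpha> p (T f) > weighted_norm \<alpha> p f)"

text \<open>
  The supremum is taken in \<open>[0,\<infinity>]\<close>, so that it is the true supremum also for unbounded \<open>T\<close>.
\<close>

definition operator_norm ::
  "real \<Rightarrow> real \<Rightarrow> ((complex \<Rightarrow> complex) \<Rightarrow> complex \<Rightarrow> complex) \<Rightarrow> ennreal" where
  "operator_norm \<alpha> p T =
     (SUP f\<in>{f \<in> weighted_space \<alpha> p. nonzero_on_disc f}.
        ennreal (weighted_norm \<alpha> p (T f) / weighted_norm \<alpha> p f))"

definition norm_attaining ::
  "real \<Rightarrow> real \<Rightarrow> ((complex \<Rightarrow> complex) \<Rightarrow> complex \<Rightarrow> complex) \<Rightarrow> bool" where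
  "norm_attaining \<alpha> p T \<longleftrightarrow>
     (\<exists>f0\<in>weighted_space \<alpha> p. weighted_norm \<alpha> p f0 = 1 \<and>
        ennreal (weighted_norm \<alpha> p (T f0)) = operator_norm \<alpha> p T)"

end

theory Submission
  imports Defs
begin

text \<open>
  Write \<open>M\<close> for the \<open>p\<close>-th power integral mean of \<open>f\<close> and \<open>w r = (1 - r\<^sup>2) powr (\<alpha> - 1)\<close> for the weight, so that
  \<open>w\<close> is increasing with \<open>w 0 = 1\<close>. Integration by parts on \<open>[0,b]\<close> turns the truncated
  \<open>p\<close>-th power of the norm into

    \<open>M(0) + \<integral>\<^sub>0\<^sup>b M' w = M(b) w(b) - \<integral>\<^sub>0\<^sup>b M w'\<close>.

  The mean of the shifted function is \<open>r\<^sup>p M(r)\<close>. Subtracting the two formulas gives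

    \<open>M(b) w(b) (b\<^sup>p - 1) + \<integral>\<^sub>0\<^sup>b (1 - s\<^sup>p) M w'\<close>

  for the increase of the truncated quantity. Since \<open>1 - s\<^sup>p = O(1 - s\<^sup>2)\<close> and \<open>\<alpha> > 0\<close>, the first term
  tends to 0 as \<open>b\<close> tends to 1, and \<open>(1 - s\<^sup>p) w'(s)\<close>, called \<open>gain\<close> below, is integrable on \<open>(0,1)\<close>. Thus
  the shift increases the \<open>p\<close>-th power of the norm by exactly \<open>\<integral>\<^sub>0\<^sup>1 M gain\<close> (lemma \<open>shift_energy\<close>). This is
  positive for nonzero \<open>f\<close>. As \<open>M(s)\<close> never exceeds the \<open>p\<close>-th power \<open>E\<close> of the norm of \<open>f\<close>, it is at most
  \<open>E \<integral>\<^sub>0\<^sup>1 gain\<close>, with equality iff \<open>M\<close> is identically \<open>E\<close>, that is, iff \<open>f\<close> is constant (lemma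
  \<open>integral_mean_constant_imp\<close>).

  Two classical facts on \<open>M\<close> have to be proved. It is increasing (lemma \<open>integral_mean_mono\<close>): finite averages of
  \<open>|f|\<^sup>p\<close> over rotations obey a maximum principle and converge to \<open>M\<close> uniformly on each circle. And it is differentiable on
  each \<open>[0,b]\<close> except perhaps at finitely many radii, those of the zeros of \<open>f\<close> (lemma
  \<open>integral_mean_differentiable_cofinite\<close>); with continuity this suffices for the integration by parts.
\<close>

section \<open>Monotonicity of the integral means\<close>

text \<open>
  The error bound is uniform in the base point \<open>t\<close> of the equidistant partition of a period.
\<close>

lemma periodic_riemann_sums_uniform:
  fixes \<phi> :: "real \<Rightarrow> real"
  assumes cont: "continuous_on UNIV \<phi>" and per: "\<And>x. \<phi> (x + 2 * pi) = \<phi> x" and "\<epsilon> > 0"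
  obtains N0 where "\<And>N t. N \<ge> N0 \<Longrightarrow> N > 0 \<Longrightarrow> t \<in> {0..2 * pi} \<Longrightarrow>
    \<bar>(\<Sum>k<N. \<phi> (t + real k * (2 * pi / real N))) / real N - integral {0..2 * pi} \<phi> / (2 * pi)\<bar> \<le> \<epsilon>"
proof -
  define P where "P = (\<lambda>x. integral {-1..x} \<phi>)"
  have contI: "continuous_on {-1..4 * pi + 1} \<phi>"
    using cont continuous_on_subset by blast
  have P': "(P has_real_derivative \<phi> x) (at x)" if "x \<in> {-1<..<4 * pi + 1}" for x
  proof -
    have "(P has_real_derivative \<phi> x) (at x within {-1..4 * pi + 1})"
      unfolding P_def using that by (intro integral_has_real_derivative contI) auto
    moreover have "at x within {-1..4 * pi + 1} = at x"
      using that by (intro at_within_Icc_at) auto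
    ultimately show ?thesis by simp
  qed
  have int: "integral {0..2 * pi} \<phi> = P (2 * pi) - P 0"
  proof -
    have "integral {-1..0} \<phi> + integral {0..2 * pi} \<phi> = integral {-1..2 * pi} \<phi>"
      by (rule Henstock_Kurzweil_Integration.integral_combine)
        (auto intro: integrable_continuous_interval continuous_on_subset[OF cont])
    then show ?thesis unfolding P_def by simp
  qed
  \<comment> \<open>by periodicity, the integral over any period is the same\<close>
  have shift: "P (t + 2 * pi) - P t = P (2 * pi) - P 0" if t: "t \<in> {0..2 * pi}" for t
  proof (cases "t = 0")
    case False
    then have "0 < t" using t by auto
    moreover have deriv0: "((\<lambda>x. P (x + 2 * pi) - P x) has_real_derivative 0) (at x)"
      if x: "0 \<le> x" "x \<le> t" for x
    proof -
      have "((\<lambda>x. P (x + 2 * pi) - P x) has_real_derivative \<phi> (x + 2 * pi) * (1 + 0) - \<phi> x) (at x)"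
        using x t by (intro DERIV_diff DERIV_chain2[OF P'] P' derivative_intros) auto
      then show ?thesis using per by simp
    qed
    then have "continuous_on {0..t} (\<lambda>x. P (x + 2 * pi) - P x)"
      by (intro DERIV_continuous_on[where D="\<lambda>_. 0"]) (auto intro: has_field_derivative_at_within)
    ultimately show ?thesis
      using DERIV_isconst_end[of 0 t "\<lambda>x. P (x + 2 * pi) - P x"] deriv0 by simp
  qed auto
  have "uniformly_continuous_on {0..4 * pi} \<phi>"
    by (intro compact_uniformly_continuous continuous_on_subset[OF cont]) auto
  then obtain d where d: "d > 0" "\<And>x y. x \<in> {0..4 * pi} \<Longrightarrow> y \<in> {0..4 * pi} \<Longrightarrow>
      \<bar>x - y\<bar> < d \<Longrightarrow> \<bar>\<phi> x - \<phi> y\<bar> < \<epsilon>"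
    using \<open>\<epsilon> > 0\<close> unfolding uniformly_continuous_on_def dist_real_def by metis
  obtain N0 :: nat where N0: "real N0 > 2 * pi / d" using reals_Archimedean2 by blast
  show thesis
  proof (rule that[of N0])
    fix N t assume N: "N \<ge> N0" "N > 0" and t: "t \<in> {0..2 * pi}"
    define h where "h = 2 * pi / real N"
    have Nh: "real N * h = 2 * pi" and h: "h > 0" using N by (auto simp: h_def)
    have "2 * pi / d < real N" using N0 N by linarith
    then have hd: "h < d" using d N by (simp add: h_def field_simps)
    let ?x = "\<lambda>k. t + real k * h"
    have piece: "\<bar>h * \<phi> (?x k) - (P (?x (Suc k)) - P (?x k))\<bar> \<le> h * \<epsilon>" if "k < N" for k
    proof -
      have "real (Suc k) * h \<le> real N * h" using that h by (intro mult_right_mono) auto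
      then have le: "?x (Suc k) \<le> 4 * pi" using t unfolding Nh by auto
      have lt: "?x k < ?x (Suc k)" using h by (simp add: algebra_simps)
      have ge: "0 \<le> ?x k" using t h by simp
      obtain z where z: "?x k < z" "z < ?x (Suc k)"
         "P (?x (Suc k)) - P (?x k) = (?x (Suc k) - ?x k) * \<phi> z"
        using MVT2[OF lt, of P \<phi>] P' ge le by force
      have "\<bar>?x k - z\<bar> < d" using z hd by (simp add: algebra_simps)
      then have "\<bar>\<phi> (?x k) - \<phi> z\<bar> < \<epsilon>" using z ge le by (intro d) auto
      moreover have "h * \<phi> (?x k) - (P (?x (Suc k)) - P (?x k)) = h * (\<phi> (?x k) - \<phi> z)"
        unfolding z(3) by (simp add: algebra_simps)
      ultimately show ?thesis using h by (simp add: abs_mult)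
    qed
    have "(\<Sum>k<N. P (?x (Suc k)) - P (?x k)) = P (t + 2 * pi) - P t"
      by (subst sum_lessThan_telescope) (simp add: Nh)
    then have tel: "(\<Sum>k<N. P (?x (Suc k)) - P (?x k)) = integral {0..2 * pi} \<phi>"
      using shift[OF t] int by simp
    have "\<bar>\<Sum>k<N. h * \<phi> (?x k) - (P (?x (Suc k)) - P (?x k))\<bar> \<le> (\<Sum>k<N. h * \<epsilon>)"
      by (rule order.trans[OF sum_abs]) (intro sum_mono piece, auto)
    then have "\<bar>h * (\<Sum>k<N. \<phi> (?x k)) - integral {0..2 * pi} \<phi>\<bar> \<le> 2 * pi * \<epsilon>"
      unfolding sum_subtractf[of "\<lambda>k. h * \<phi> (?x k)"] tel
      using Nh by (simp add: sum_distrib_left mult.assoc[symmetric])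
    then have "\<bar>h * (\<Sum>k<N. \<phi> (?x k)) - integral {0..2 * pi} \<phi>\<bar> / (2 * pi) \<le> \<epsilon>"
      by (simp add: field_simps)
    also have "\<bar>h * (\<Sum>k<N. \<phi> (?x k)) - integral {0..2 * pi} \<phi>\<bar> / (2 * pi) =
       \<bar>(h * (\<Sum>k<N. \<phi> (?x k)) - integral {0..2 * pi} \<phi>) / (2 * pi)\<bar>"
      by (simp add: abs_divide)
    also have "(h * (\<Sum>k<N. \<phi> (?x k)) - integral {0..2 * pi} \<phi>) / (2 * pi) =
       (\<Sum>k<N. \<phi> (?x k)) / real N - integral {0..2 * pi} \<phi> / (2 * pi)"
      unfolding h_def by (simp add: field_simps)
    finally show "\<bar>(\<Sum>k<N. \<phi> (t + real k * (2 * pi / real N))) / real N - integral {0..2 * pi} \<phi> / (2 * pi)\<bar> \<le> \<epsilon>"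
      unfolding h_def .
  qed
qed

lemma holomorphic_log_on_small_ball:
  assumes "f holomorphic_on S" "open S" "a \<in> S" "f a \<noteq> 0"
  obtains \<delta> g where "\<delta> > 0" "ball a \<delta> \<subseteq> S" "g holomorphic_on ball a \<delta>"
    "\<And>z. z \<in> ball a \<delta> \<Longrightarrow> f z = exp (g z)"
proof -
  have "continuous_on S f" using assms holomorphic_on_imp_continuous_on by blast
  then have "open (S \<inter> f -` (-{0}))"
    using assms(2) by (intro continuous_open_preimage) auto
  then obtain \<delta> where \<delta>: "\<delta> > 0" "ball a \<delta> \<subseteq> S \<inter> f -` (-{0})"
    using assms openE[of "S \<inter> f -` (-{0})" a] by blast
  have "f holomorphic_on ball a \<delta>" using \<delta> assms holomorphic_on_subset by blast
  then obtain g where "g holomorphic_on ball a \<delta>" "\<And>z. z \<in> ball a \<delta> \<Longrightarrow> f z = exp (g z)"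
    using contractible_imp_holomorphic_log[of f "ball a \<delta>"] \<delta>
    by (metis IntD2 Compl_iff convex_ball convex_imp_contractible singletonI subsetD vimageE)
  then show thesis using that \<delta> by blast
qed

lemma exp_powr: "exp (x::real) powr p = exp (p * x)"
  by (simp add: powr_def)

text \<open>
  \<open>|f|\<^sup>p\<close> is touched from below at every point \<open>a\<close> by a constant plus the real part of a
  holomorphic function. At a zero of \<open>f\<close> this is trivial. Elsewhere \<open>f = exp g\<close> near \<open>a\<close>, and the
  support is the inequality \<open>1 + x \<le> exp x\<close> for \<open>x = p Re (g z - g a)\<close>. This form of
  subharmonicity is stable under finite sums.
\<close>

lemma norm_powr_support:
  assumes "f holomorphic_on S" "open S" "a \<in> S"
  obtains \<delta> \<Lambda> where "\<delta> > 0" "ball a \<delta> \<subseteq> S" "\<Lambda> holomorphic_on ball a \<delta>" "\<Lambda> a = 0"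
    "\<And>z. z \<in> ball a \<delta> \<Longrightarrow> norm (f a) powr p + Re (\<Lambda> z) \<le> norm (f z) powr p"
proof (cases "f a = 0")
  case True
  obtain \<delta> where "\<delta> > 0" "ball a \<delta> \<subseteq> S" using assms openE by blast
  then show thesis using True by (intro that[of \<delta> "\<lambda>_. 0"]) auto
next
  case False
  obtain \<delta> g where \<delta>: "\<delta> > 0" "ball a \<delta> \<subseteq> S" and g: "g holomorphic_on ball a \<delta>"
    "\<And>z. z \<in> ball a \<delta> \<Longrightarrow> f z = exp (g z)"
    using holomorphic_log_on_small_ball[OF assms(1-3) False] by blast
  define c where "c = norm (f a) powr p"
  define \<Lambda> where "\<Lambda> = (\<lambda>z. of_real (c * p) * (g z - g a))"
  have "c + Re (\<Lambda> z) \<le> norm (f z) powr p" if z: "z \<in> ball a \<delta>" for z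
  proof -
    have "norm (f z) powr p = exp (p * Re (g a) + p * Re (g z - g a))"
      by (simp add: g(2)[OF z] exp_powr right_diff_distrib)
    also have "\<dots> = c * exp (p * Re (g z - g a))"
      unfolding c_def using \<delta> by (simp add: g(2)[of a] exp_powr exp_add)
    also have "\<dots> \<ge> c * (1 + p * Re (g z - g a))"
      by (intro mult_left_mono) (auto simp: c_def)
    finally show ?thesis by (simp add: \<Lambda>_def algebra_simps)
  qed
  then show thesis using \<delta> g unfolding c_def
    by (intro that[of \<delta> \<Lambda>]) (auto simp: \<Lambda>_def intro!: holomorphic_intros)
qed

text \<open>
  The maximum principle for functions with such supports: among all maximum points on the closed
  disc, take one of greatest modulus. Were it interior, the support \<open>\<Lambda>\<close> would have nonpositive real
  part near it, so \<open>exp \<Lambda>\<close> would attain its maximum modulus there and be constant, and \<open>u\<close> would be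
  maximal on a whole neighbourhood, which contains points of greater modulus.
\<close>

lemma support_maximum_principle:
  fixes u :: "complex \<Rightarrow> real"
  assumes cont: "continuous_on (cball 0 R) u" and "R > 0"
    and supp: "\<And>a. a \<in> ball 0 R \<Longrightarrow> \<exists>\<delta>>0. \<exists>\<Lambda>. \<Lambda> holomorphic_on ball a \<delta> \<and> \<Lambda> a = 0 \<and>
       (\<forall>z\<in>ball a \<delta>. u a + Re (\<Lambda> z) \<le> u z)"
  obtains w where "norm w = R" "\<And>z. z \<in> cball 0 R \<Longrightarrow> u z \<le> u w"
proof -
  obtain m where m: "m \<in> cball 0 R" "\<And>z. z \<in> cball 0 R \<Longrightarrow> u z \<le> u m"
    using continuous_attains_sup[OF compact_cball _ cont] \<open>R > 0\<close> by auto
  define K where "K = {z \<in> cball 0 R. u z = u m}"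
  have "K = cball 0 R \<inter> u -` {u m}" by (auto simp: K_def)
  moreover have "closed (cball 0 R \<inter> u -` {u m})"
    by (intro continuous_closed_preimage cont) auto
  ultimately have "compact K"
    by (metis bounded_cball bounded_subset compact_eq_bounded_closed inf_le1)
  then obtain w where w: "w \<in> K" "\<And>z. z \<in> K \<Longrightarrow> norm z \<le> norm w"
    using continuous_attains_sup[of K norm] m by (auto simp: K_def intro: continuous_intros)
  have "norm w = R"
  proof (rule ccontr)
    assume "norm w \<noteq> R"
    then have wR: "norm w < R" using w by (auto simp: K_def)
    then obtain \<delta> \<Lambda> where \<delta>: "\<delta> > 0" and hol: "\<Lambda> holomorphic_on ball w \<delta>" and L: "\<Lambda> w = 0"
       "\<And>z. z \<in> ball w \<delta> \<Longrightarrow> u w + Re (\<Lambda> z) \<le> u z"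
      using supp[of w] by auto
    define e where "e = min \<delta> (R - norm w)"
    have e: "e > 0" "e \<le> \<delta>" using \<delta> wR by (auto simp: e_def)
    have sub: "z \<in> cball 0 R" if "z \<in> ball w e" for z
    proof -
      have "norm z \<le> norm w + dist w z" by (metis dist_norm norm_minus_commute norm_triangle_sub)
      then show ?thesis using that by (auto simp: e_def)
    qed
    have Re0: "Re (\<Lambda> z) \<le> 0" if "z \<in> ball w e" for z
      using L(2)[of z] m(2)[OF sub[OF that]] w(1) that e by (auto simp: K_def)
    have "(\<lambda>z. exp (\<Lambda> z)) constant_on ball w e"
      using e Re0 L by (intro maximum_modulus_principle[of _ "ball w e" "ball w e" w])
        (auto intro!: holomorphic_intros holomorphic_on_subset[OF hol])
    then have const: "exp (\<Lambda> z) = 1" if "z \<in> ball w e" for z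
      using that e L unfolding constant_on_def by (metis centre_in_ball exp_zero)
    have "z \<in> K" if z: "z \<in> ball w e" for z
    proof -
      have "Re (\<Lambda> z) = 0" using const[OF z] by (metis exp_eq_1)
      then have "u z \<ge> u w" using L(2)[of z] z e by auto
      then show ?thesis using w(1) sub[OF z] m(2)[of z] by (auto simp: K_def)
    qed
    \<comment> \<open>a point of the ball that is further away from the origin\<close>
    moreover define v where "v = w + of_real (e / 2) * (if w = 0 then 1 else sgn w)"
    moreover have "v \<in> ball w e" using e by (auto simp: v_def dist_norm norm_mult norm_sgn)
    moreover have "norm v > norm w"
    proof (cases "w = 0")
      case False
      then have "v = of_real (norm w + e / 2) * sgn w"
        by (simp add: v_def sgn_div_norm scaleR_conv_of_real field_simps)
      moreover have "norm w + e / 2 > 0" using e by (simp add: add_nonneg_pos)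
      ultimately have "norm v = norm w + e / 2" using False
        by (simp only: norm_mult norm_sgn norm_of_real) simp
      then show ?thesis using e by simp
    qed (use e in \<open>simp add: v_def\<close>)
    ultimately show False using w(2)[of v] by auto
  qed
  then show thesis using that[of w] m w(1) by (auto simp: K_def)
qed

lemma continuous_on_norm_powr:
  fixes f :: "'a::topological_space \<Rightarrow> complex"
  assumes "continuous_on S f" "0 < p"
  shows "continuous_on S (\<lambda>z. norm (f z) powr p)"
  using assms by (intro continuous_on_powr' continuous_intros) auto

lemma polar_in_disc: "0 \<le> r \<Longrightarrow> r < R \<Longrightarrow> of_real r * exp (\<i> * of_real t) \<in> ball (0::complex) R"
  by (simp add: norm_mult)

lemma continuous_on_polar:
  assumes "f holomorphic_on ball 0 1" "0 < p"
  shows "continuous_on ({0..<1} \<times> S) (\<lambda>(r, \<theta>). norm (f (of_real r * exp (\<i> * of_real \<theta>))) powr p)"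
proof -
  have "continuous_on (ball 0 1) (\<lambda>z. norm (f z) powr p)"
    using assms by (intro continuous_on_norm_powr holomorphic_on_imp_continuous_on)
  then show ?thesis unfolding case_prod_beta
    by (rule continuous_on_compose2) (auto intro!: continuous_intros polar_in_disc simp: norm_mult)
qed

lemma continuous_on_circle:
  assumes "f holomorphic_on ball 0 1" "0 < p" "0 \<le> r" "r < 1"
  shows "continuous_on S (\<lambda>\<theta>. norm (f (of_real r * exp (\<i> * of_real \<theta>))) powr p)"
proof -
  have "continuous_on S (Pair r)" by (intro continuous_intros)
  then show ?thesis
    using continuous_on_compose2[OF continuous_on_polar[OF assms(1,2)], of S "Pair r" S] assms
    by (simp add: image_subset_iff)
qed

lemma integral_mean_eq:
  assumes "f holomorphic_on ball 0 1" "0 < p" "0 \<le> r" "r < 1"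
  shows "integral_mean p f r =
    integral {0..2 * pi} (\<lambda>\<theta>. norm (f (of_real r * exp (\<i> * of_real \<theta>))) powr p) / (2 * pi)"
proof -
  have "set_integrable lborel {0..2 * pi} (\<lambda>\<theta>. norm (f (of_real r * exp (\<i> * of_real \<theta>))) powr p / (2 * pi))"
    by (intro borel_integrable_atLeastAtMost' continuous_intros continuous_on_circle assms) auto
  then show ?thesis unfolding integral_mean_def
    by (simp add: set_borel_integral_eq_integral(2))
qed

lemma integral_mean_nonneg: "0 \<le> integral_mean p f r"
  unfolding integral_mean_def set_lebesgue_integral_def by (intro integral_nonneg_AE) auto

lemma integral_mean_0: "f holomorphic_on ball 0 1 \<Longrightarrow> 0 < p \<Longrightarrow> integral_mean p f 0 = norm (f 0) powr p"
  by (simp add: integral_mean_eq)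

lemma integral_mean_continuous:
  assumes "f holomorphic_on ball 0 1" "0 < p"
  shows "continuous_on {0..<1} (integral_mean p f)"
proof -
  have "continuous_on {0..<1} (\<lambda>r. integral (cbox 0 (2 * pi)) (\<lambda>\<theta>. norm (f (of_real r * exp (\<i> * of_real \<theta>))) powr p) / (2 * pi))"
    by (intro continuous_intros integral_continuous_on_param continuous_on_polar assms) auto
  then show ?thesis
    by (rule continuous_on_eq) (auto simp: integral_mean_eq[OF assms])
qed

text \<open>
  The average \<open>G / N\<close> of \<open>|f|\<^sup>p\<close> over the \<open>N\<close> rotations by roots of unity satisfies the maximum
  principle and is, on each circle, uniformly close to the integral mean. The finite average is
  needed because a continuous one has no common radius on which the supports exist when \<open>f\<close> has
  zeros on the circle.
\<close>

lemma integral_mean_mono: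
  assumes hol: "f holomorphic_on ball 0 1" and p: "0 < p" and "0 \<le> r" "r < R" "R < 1"
  shows "integral_mean p f r \<le> integral_mean p f R"
proof (rule field_le_epsilon)
  fix e :: real assume "e > 0"
  define \<phi> where "\<phi> = (\<lambda>\<rho> \<theta>. norm (f (of_real \<rho> * exp (\<i> * of_real \<theta>))) powr p)"
  have e2: "e / 2 > 0" using \<open>e > 0\<close> by simp
  have per: "\<phi> \<rho> (x + 2 * pi) = \<phi> \<rho> x" for \<rho> x
    using exp_two_pi_i' by (simp add: \<phi>_def exp_add ring_distribs mult.commute[of 2])
  have c: "continuous_on UNIV (\<phi> r)" "continuous_on UNIV (\<phi> R)"
    unfolding \<phi>_def using assms by (auto intro!: continuous_on_circle)
  obtain N1 where N1: "\<And>N t. N \<ge> N1 \<Longrightarrow> N > 0 \<Longrightarrow> t \<in> {0..2 * pi} \<Longrightarrow>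
    \<bar>(\<Sum>k<N. \<phi> r (t + real k * (2 * pi / real N))) / real N - integral {0..2 * pi} (\<phi> r) / (2 * pi)\<bar> \<le> e / 2"
    using periodic_riemann_sums_uniform[OF c(1) per e2] by blast
  obtain N2 where N2: "\<And>N t. N \<ge> N2 \<Longrightarrow> N > 0 \<Longrightarrow> t \<in> {0..2 * pi} \<Longrightarrow>
    \<bar>(\<Sum>k<N. \<phi> R (t + real k * (2 * pi / real N))) / real N - integral {0..2 * pi} (\<phi> R) / (2 * pi)\<bar> \<le> e / 2"
    using periodic_riemann_sums_uniform[OF c(2) per e2] by blast
  define N where "N = max 1 (max N1 N2)"
  have N: "N > 0" "N \<ge> N1" "N \<ge> N2" by (auto simp: N_def)
  define \<omega> where "\<omega> = (\<lambda>k. exp (\<i> * of_real (real k * (2 * pi / real N))))"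
  define G where "G = (\<lambda>z. \<Sum>k<N. norm (f (z * \<omega> k)) powr p)"
  have [simp]: "norm (\<omega> k) = 1" for k unfolding \<omega>_def norm_exp_i_times by simp
  have G_eq: "G (of_real \<rho> * exp (\<i> * of_real t)) = (\<Sum>k<N. \<phi> \<rho> (t + real k * (2 * pi / real N)))" for \<rho> t
    unfolding G_def \<phi>_def \<omega>_def by (simp add: exp_add[symmetric] mult.assoc ring_distribs del: of_real_mult of_real_divide)
  have holk: "(\<lambda>z. f (z * \<omega> k)) holomorphic_on ball 0 1" for k
    by (rule holomorphic_on_compose_gen[OF _ hol, unfolded o_def])
      (auto intro!: holomorphic_intros simp: norm_mult)
  have contG: "continuous_on (cball 0 R) G"
    unfolding G_def using \<open>R < 1\<close>
    by (intro continuous_on_sum continuous_on_norm_powr p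
        continuous_on_subset[OF holomorphic_on_imp_continuous_on[OF holk]]) auto
  have supp: "\<exists>\<delta>>0. \<exists>\<Lambda>. \<Lambda> holomorphic_on ball a \<delta> \<and> \<Lambda> a = 0 \<and>
       (\<forall>z\<in>ball a \<delta>. G a + Re (\<Lambda> z) \<le> G z)" if a: "a \<in> ball 0 R" for a
  proof -
    \<comment> \<open>the supports of the finitely many terms add up to one on the smallest of the balls\<close>
    have "\<exists>d L. d > 0 \<and> L holomorphic_on ball a d \<and> L a = 0 \<and>
      (\<forall>z\<in>ball a d. norm (f (a * \<omega> k)) powr p + Re (L z) \<le> norm (f (z * \<omega> k)) powr p)" for k
    proof -
      have "a \<in> ball 0 1" using a \<open>R < 1\<close> by auto
      from norm_powr_support[OF holk open_ball this, of k p] show ?thesis by metis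
    qed
    then obtain d L where dL: "\<And>k. d k > 0" "\<And>k. L k holomorphic_on ball a (d k)" "\<And>k. L k a = 0"
      "\<And>k z. z \<in> ball a (d k) \<Longrightarrow> norm (f (a * \<omega> k)) powr p + Re (L k z) \<le> norm (f (z * \<omega> k)) powr p"
      by metis
    define \<delta> where "\<delta> = Min (d ` {..<N})"
    have \<delta>: "\<delta> > 0" "\<And>k. k < N \<Longrightarrow> \<delta> \<le> d k"
      using N(1) dL(1) unfolding \<delta>_def by (subst Min_gr_iff) (auto simp: lessThan_empty_iff)
    have "(\<lambda>z. \<Sum>k<N. L k z) holomorphic_on ball a \<delta>"
      using \<delta> by (intro holomorphic_on_sum holomorphic_on_subset[OF dL(2)] subset_ball) auto
    moreover have "G a + Re (\<Sum>k<N. L k z) \<le> G z" if "z \<in> ball a \<delta>" for z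
    proof -
      have "(\<Sum>k<N. norm (f (a * \<omega> k)) powr p + Re (L k z)) \<le> G z"
        unfolding G_def using that \<delta>(2) by (intro sum_mono dL(4)) fastforce
      then show ?thesis by (simp add: G_def sum.distrib)
    qed
    ultimately show ?thesis using \<delta>(1) dL(3)
      by (intro exI[of _ \<delta>] conjI exI[of _ "\<lambda>z. \<Sum>k<N. L k z"]) auto
  qed
  obtain w where w: "norm w = R" "\<And>z. z \<in> cball 0 R \<Longrightarrow> G z \<le> G w"
    using support_maximum_principle[OF contG _ supp] assms by auto
  obtain t where t: "t \<in> {0..2 * pi}" "w = of_real R * exp (\<i> * of_real t)"
    using Arg2pi_eq[of w] Arg2pi_ge_0[of w] Arg2pi_lt_2pi[of w] w(1)
    by (intro that[of "Arg2pi w"]) (auto simp: less_imp_le)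
  have "G (of_real r) \<le> G w" using assms by (intro w(2)) auto
  then have "(\<Sum>k<N. \<phi> r (0 + real k * (2 * pi / real N))) / real N \<le> (\<Sum>k<N. \<phi> R (t + real k * (2 * pi / real N))) / real N"
    using G_eq[of r 0] G_eq[of R t] t N by (intro divide_right_mono) auto
  moreover have zero: "0 \<in> {0..2 * pi}" by simp
  moreover have "x \<le> y \<Longrightarrow> \<bar>x - a\<bar> \<le> e / 2 \<Longrightarrow> \<bar>y - b\<bar> \<le> e / 2 \<Longrightarrow> a \<le> b + e" for x y a b
    by linarith
  ultimately have "integral {0..2 * pi} (\<phi> r) / (2 * pi) \<le> integral {0..2 * pi} (\<phi> R) / (2 * pi) + e"
    using N1[OF N(2,1) zero] N2[OF N(3,1) t(1)] by blast
  then show "integral_mean p f r \<le> integral_mean p f R + e"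
    using assms by (simp add: integral_mean_eq \<phi>_def)
qed

lemma integral_mean_mono_on:
  assumes "f holomorphic_on ball 0 1" "0 < p"
  shows "mono_on {0..<1} (integral_mean p f)"
  using integral_mean_mono[OF assms] by (intro mono_onI) (force simp: order_le_less)

section \<open>Differentiability of the integral means\<close>

lemma DERIV_norm_powr:
  assumes "(g has_vector_derivative g') (at x within S)" "g x \<noteq> (0::complex)"
  shows "((\<lambda>x. norm (g x) powr p) has_real_derivative
     p * norm (g x) powr (p - 2) * Re (cnj (g x) * g')) (at x within S)"
proof -
  have "(norm has_derivative (\<lambda>h. inner h (sgn (g x)))) (at (g x))"
    using has_derivative_norm[OF assms(2)] by simp
  then have "((\<lambda>x. norm (g x)) has_derivative (\<lambda>h. inner (h *\<^sub>R g') (sgn (g x)))) (at x within S)"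
    by (rule has_derivative_compose[OF assms(1)[unfolded has_vector_derivative_def]])
  then have "((\<lambda>x. norm (g x)) has_real_derivative inner g' (sgn (g x))) (at x within S)"
    by (simp add: has_field_derivative_def mult_commute_abs)
  then have "((\<lambda>x. norm (g x) powr p) has_real_derivative
      p * norm (g x) powr (p - 1) * inner g' (sgn (g x))) (at x within S)"
    using assms(2) by (intro DERIV_chain2[OF has_real_derivative_powr]) auto
  moreover have "norm (g x) powr (p - 1) * inner g' (sgn (g x)) = norm (g x) powr (p - 2) * Re (cnj (g x) * g')"
  proof -
    have "norm (g x) powr (p - 1) = norm (g x) powr (p - 2) * norm (g x)"
      using assms(2) by (simp add: powr_diff power2_eq_square)
    moreover have "norm (g x) * inner g' (sgn (g x)) = Re (cnj (g x) * g')"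
      using assms(2) by (simp add: sgn_div_norm inner_complex_def algebra_simps)
    ultimately show ?thesis by (simp add: mult.assoc)
  qed
  ultimately show ?thesis by (simp add: mult.assoc)
qed

text \<open>
  Without zeros on the circle, \<open>|f|\<^sup>p\<close> is smooth near it, and one may differentiate under the
  integral sign.
\<close>

lemma integral_mean_differentiable:
  assumes hol: "f holomorphic_on ball 0 1" and p: "0 < p" and r: "0 < r" "r < 1"
    and nz: "\<And>z. norm z = r \<Longrightarrow> f z \<noteq> 0"
  shows "\<exists>D. (integral_mean p f has_real_derivative D) (at r)"
proof -
  have contf: "continuous_on (ball 0 1) f" using hol holomorphic_on_imp_continuous_on by blast
  \<comment> \<open>an annulus around the circle that is free of zeros\<close>
  obtain e where e: "e > 0" "e < r" "r + e < 1"
    and nz': "\<And>z. \<bar>norm z - r\<bar> < e \<Longrightarrow> f z \<noteq> 0"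
  proof -
    define d where "d = min r (1 - r) / 2"
    have d: "d > 0" "d < r" "r + d < 1" using r by (auto simp: d_def min_def field_simps)
    define K where "K = norm ` {z \<in> cball 0 (r + d). f z = 0}"
    have "{z \<in> cball 0 (r + d). f z = 0} = cball 0 (r + d) \<inter> f -` {0}" by auto
    moreover have "closed (cball 0 (r + d) \<inter> f -` {0})"
      using d by (intro continuous_closed_preimage continuous_on_subset[OF contf]) auto
    ultimately have "compact {z \<in> cball 0 (r + d). f z = 0}"
      by (metis bounded_cball bounded_subset compact_eq_bounded_closed inf_le1)
    then have "closed K" unfolding K_def
      by (intro compact_imp_closed compact_continuous_image continuous_intros)
    moreover have "r \<in> - K" using nz by (auto simp: K_def)
    ultimately obtain e where e: "e > 0" "ball r e \<subseteq> - K"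
      using openE[of "- K" r] by (auto simp: closed_def)
    show thesis
    proof (rule that[of "min e d"])
      fix z :: complex assume z: "\<bar>norm z - r\<bar> < min e d"
      then have "norm z \<notin> K" using e(2) by (auto simp: dist_real_def abs_minus_commute subset_iff)
      then show "f z \<noteq> 0" using z by (auto simp: K_def)
    qed (use e d in \<open>auto simp: min_def\<close>)
  qed
  define U where "U = {r - e<..<r + e}"
  define z where "z = (\<lambda>(r::real) (t::real). of_real r * exp (\<i> * of_real t))"
  have nrm: "norm (z \<rho> t) = \<bar>\<rho>\<bar>" for \<rho> t by (simp add: z_def norm_mult)
  have U: "\<rho> \<in> {0..<1}" "f (z \<rho> t) \<noteq> 0" "z \<rho> t \<in> ball 0 1" if "\<rho> \<in> U" for \<rho> t
    using that e by (auto simp: U_def nrm intro!: nz')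
  define D where "D = (\<lambda>\<rho> t. p * norm (f (z \<rho> t)) powr (p - 2) * Re (cnj (f (z \<rho> t)) * (exp (\<i> * of_real t) * deriv f (z \<rho> t))))"
  have "((\<lambda>\<rho>. integral (cbox 0 (2 * pi)) (\<lambda>t. norm (f (z \<rho> t)) powr p)) has_field_derivative
      integral (cbox 0 (2 * pi)) (D r)) (at r within U)"
  proof (rule leibniz_rule_field_derivative)
    fix \<rho> t assume \<rho>: "\<rho> \<in> U"
    have "(f has_field_derivative deriv f (z \<rho> t)) (at (z \<rho> t))"
      using U(3)[OF \<rho>] hol holomorphic_derivI by blast
    moreover have "((\<lambda>x. z x t) has_vector_derivative exp (\<i> * of_real t)) (at \<rho> within U)"
      unfolding z_def by (auto intro!: derivative_eq_intros)
    ultimately have "((\<lambda>x. f (z x t)) has_vector_derivative exp (\<i> * of_real t) * deriv f (z \<rho> t)) (at \<rho> within U)"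
      using field_vector_diff_chain_within[of "\<lambda>x. z x t" _ \<rho> U f "deriv f (z \<rho> t)"] 
      by (auto simp: o_def intro: has_field_derivative_at_within)
    from DERIV_norm_powr[OF this U(2)[OF \<rho>]]
    show "((\<lambda>x. norm (f (z x t)) powr p) has_field_derivative D \<rho> t) (at \<rho> within U)"
      unfolding D_def .
  next
    show "(\<lambda>t. norm (f (z \<rho> t)) powr p) integrable_on cbox 0 (2 * pi)" if "\<rho> \<in> U" for \<rho>
      unfolding z_def using U(1)[OF that]
      by (intro integrable_continuous continuous_on_circle hol p) auto
  next
    have cz: "continuous_on (U \<times> cbox 0 (2 * pi)) (\<lambda>x. z (fst x) (snd x))"
      unfolding z_def by (intro continuous_intros)
    have *: "continuous_on (U \<times> cbox 0 (2 * pi)) (\<lambda>x. F (z (fst x) (snd x)))"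
      if "F holomorphic_on ball 0 1" for F
      using U(3) by (intro continuous_on_compose2[OF holomorphic_on_imp_continuous_on[OF that] cz]) auto
    have "deriv f holomorphic_on ball 0 1" using hol by (intro holomorphic_deriv) auto
    from *[OF this] *[OF hol] show "continuous_on (U \<times> cbox 0 (2 * pi)) (\<lambda>(\<rho>, t). D \<rho> t)"
      unfolding D_def case_prod_beta using U(2)
      by (intro continuous_intros) auto
  qed (use e in \<open>auto simp: U_def\<close>)
  then have "((\<lambda>\<rho>. integral (cbox 0 (2 * pi)) (\<lambda>t. norm (f (z \<rho> t)) powr p) / (2 * pi)) has_field_derivative
      integral (cbox 0 (2 * pi)) (D r) / (2 * pi)) (at r within U)"
    by (rule DERIV_cdivide)
  then have "(integral_mean p f has_real_derivative integral (cbox 0 (2 * pi)) (D r) / (2 * pi)) (at r within U)"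
    by (rule has_field_derivative_transform_within[where d = e])
      (use e U in \<open>auto simp: U_def z_def integral_mean_eq[OF hol p]\<close>)
  then show ?thesis using at_within_open[of r U] e by (auto simp: U_def)
qed

text \<open>
  The finite exceptional set consists of the moduli of the zeros. The integral mean is in fact
  differentiable at those radii too, but a finite set is harmless for the fundamental theorem of
  calculus.
\<close>

lemma integral_mean_differentiable_cofinite:
  assumes hol: "f holomorphic_on ball 0 1" and p: "0 < p" and b: "b < 1"
  obtains E where "finite E"
    "\<And>r. r \<in> {0<..<b} - E \<Longrightarrow> (integral_mean p f has_real_derivative deriv (integral_mean p f) r) (at r)"
proof (cases "f constant_on ball 0 1")
  case True
  then obtain c where c: "\<And>z. z \<in> ball 0 1 \<Longrightarrow> f z = c" by (auto simp: constant_on_def)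
  have "(integral_mean p f has_real_derivative 0) (at r)" if r: "r \<in> {0<..<b} - {}" for r
  proof -
    have "integral_mean p f x = norm c powr p" if "x \<in> {0<..<1}" for x
      using that c[OF polar_in_disc[of x 1]] by (simp add: integral_mean_eq[OF hol p])
    then have "((\<lambda>_. norm c powr p) has_real_derivative 0) (at r) \<longleftrightarrow> ?thesis"
      using r b by (intro DERIV_cong_ev refl eventually_mono[OF eventually_nhds_in_open[of "{0<..<1}" r]]) auto
    then show ?thesis by simp
  qed
  then show thesis using that[of "{}"] DERIV_imp_deriv by (metis finite.emptyI)
next
  case False
  have "finite {z \<in> cball 0 b. f z = 0}"
    using b by (intro holomorphic_compact_finite_zeros[OF hol open_ball connected_ball _ _ False]) auto
  then show thesis
  proof (intro that[of "norm ` {z \<in> cball 0 b. f z = 0}"] finite_imageI)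
    fix r assume r: "r \<in> {0<..<b} - norm ` {z \<in> cball 0 b. f z = 0}"
    then have "\<exists>D. (integral_mean p f has_real_derivative D) (at r)"
      using b by (intro integral_mean_differentiable[OF hol p]) auto
    then show "(integral_mean p f has_real_derivative deriv (integral_mean p f) r) (at r)"
      using DERIV_imp_deriv by metis
  qed
qed

section \<open>Functions with constant integral mean\<close>

lemma mean_value_circle:
  assumes hol: "g holomorphic_on ball 0 \<delta>" and r: "0 < r" "r < \<delta>"
  shows "((\<lambda>\<theta>. g (of_real r * exp (\<i> * of_real \<theta>))) has_integral 2 * of_real pi * g 0) {0..2 * pi}"
proof -
  have "((\<lambda>u. g u / (u - 0)) has_contour_integral (2 * of_real pi * \<i> * g 0)) (circlepath 0 r)"
    using r by (intro Cauchy_integral_circlepath_simple holomorphic_on_subset[OF hol]) auto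
  then have "((\<lambda>t. g (0 + r * cis t) / (0 + r * cis t - 0) * r * \<i> * cis t) has_integral
      (2 * of_real pi * \<i> * g 0)) {0..2 * pi}"
    unfolding circlepath_def by (subst (asm) has_contour_integral_part_circlepath_iff) auto
  then have "((\<lambda>t. \<i> * g (of_real r * cis t)) has_integral (\<i> * (2 * of_real pi * g 0))) {0..2 * pi}"
    by (rule has_integral_eq_rhs[OF has_integral_eq[rotated]]) (use r in auto)
  from has_integral_mult_right[OF this, of "-\<i>"] show ?thesis
    by (simp add: cis_conv_exp)
qed

lemma integral_mean_eq_0_imp:
  assumes hol: "f holomorphic_on ball 0 1" and p: "0 < p" and z: "norm z < 1"
    and 0: "integral_mean p f (norm z) = 0"
  shows "f z = 0"
proof -
  have z_eq: "z = of_real (norm z) * exp (\<i> * of_real (Arg2pi z))" using Arg2pi_eq[of z] by simp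
  have "integral {0..2 * pi} (\<lambda>\<theta>. norm (f (of_real (norm z) * exp (\<i> * of_real \<theta>))) powr p) = 0"
    using 0 integral_mean_eq[OF hol p _ z] by simp
  then have "\<forall>\<theta>\<in>{0..2 * pi}. norm (f (of_real (norm z) * exp (\<i> * of_real \<theta>))) powr p = 0"
    by (subst (asm) integral_eq_0_iff) (auto intro!: continuous_on_circle[OF hol p] z)
  moreover have "Arg2pi z \<in> {0..2 * pi}"
    using Arg2pi_ge_0[of z] Arg2pi_lt_2pi[of z] by (simp add: less_imp_le)
  ultimately show ?thesis using z_eq by fastforce
qed

text \<open>
  If \<open>f 0 \<noteq> 0\<close>, write \<open>f = exp g\<close> near 0. Over each small circle, \<open>x = p (Re g - Re (g 0))\<close> has mean 0
  by the mean value property and \<open>exp x\<close> has mean 1 by assumption, so equality holds in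
  \<open>1 + x \<le> exp x\<close>; hence \<open>|f|\<close> is constant near 0.
\<close>

lemma integral_mean_constant_imp:
  assumes hol: "f holomorphic_on ball 0 1" and p: "0 < p"
    and const: "\<And>r. r \<in> {0<..<1} \<Longrightarrow> integral_mean p f r = norm (f 0) powr p"
  shows "f constant_on ball 0 1"
proof (cases "f 0 = 0")
  case True
  have "f z = 0" if "z \<in> ball 0 1" for z
    using that True const[of "norm z"] by (cases "z = 0") (auto intro!: integral_mean_eq_0_imp[OF hol p])
  then show ?thesis by (auto simp: constant_on_def)
next
  case False
  obtain \<delta> g where \<delta>: "\<delta> > 0" "ball 0 \<delta> \<subseteq> ball (0::complex) 1" and g: "g holomorphic_on ball 0 \<delta>"
    "\<And>z. z \<in> ball 0 \<delta> \<Longrightarrow> f z = exp (g z)"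
    using holomorphic_log_on_small_ball[OF hol open_ball _ False] by auto
  have "\<delta> \<le> 1" using \<delta> by (simp add: ball_subset_ball_iff)
  have "norm (f z) = norm (f 0)" if z: "z \<in> ball 0 \<delta>" for z
  proof (cases "z = 0")
    case z0: False
    define r where "r = norm z"
    have r: "0 < r" "r < \<delta>" "r < 1" using z z0 \<open>\<delta> \<le> 1\<close> by (auto simp: r_def)
    define c where "c = norm (f 0) powr p"
    have c: "c > 0" "c = exp (p * Re (g 0))" using False g(2)[of 0] \<delta> by (auto simp: c_def exp_powr)
    define y where "y = (\<lambda>\<theta>. of_real r * exp (\<i> * of_real \<theta>) :: complex)"
    have y: "y \<theta> \<in> ball 0 \<delta>" for \<theta> unfolding y_def using r by (intro polar_in_disc) auto
    define x where "x = (\<lambda>\<theta>. p * (Re (g (y \<theta>)) - Re (g 0)))"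
    have "((\<lambda>\<theta>. g (y \<theta>)) has_integral 2 * of_real pi * g 0) {0..2 * pi}"
      unfolding y_def using mean_value_circle[OF g(1)] r by simp
    from has_integral_linear[OF this bounded_linear_Re]
    have "((\<lambda>\<theta>. Re (g (y \<theta>))) has_integral 2 * pi * Re (g 0)) {0..2 * pi}"
      by (simp add: o_def)
    then have "((\<lambda>\<theta>. Re (g (y \<theta>)) - Re (g 0)) has_integral (2 * pi * Re (g 0) - (2 * pi - 0) * Re (g 0))) {0..2 * pi}"
      using has_integral_const_real[of "Re (g 0)" 0 "2 * pi"] by (intro has_integral_diff) auto
    from has_integral_mult_right[OF this, of p] have x_int: "(x has_integral 0) {0..2 * pi}"
      by (simp add: x_def)
    have exp_x: "exp (x \<theta>) = norm (f (y \<theta>)) powr p / c" for \<theta>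
      using g(2)[OF y] c(2) by (simp add: x_def exp_powr exp_diff right_diff_distrib)
    have "integral {0..2 * pi} (\<lambda>\<theta>. norm (f (y \<theta>)) powr p) = 2 * pi * c"
      using const[of r] integral_mean_eq[OF hol p, of r] r by (simp add: y_def c_def field_simps)
    moreover have cont: "continuous_on {0..2 * pi} (\<lambda>\<theta>. norm (f (y \<theta>)) powr p)"
      unfolding y_def using r by (intro continuous_on_circle hol p) auto
    ultimately have "((\<lambda>\<theta>. norm (f (y \<theta>)) powr p) has_integral 2 * pi * c) {0..2 * pi}"
      by (metis integrable_continuous_interval integrable_integral)
    from has_integral_divide[OF this, of c] have "((\<lambda>\<theta>. exp (x \<theta>)) has_integral 2 * pi) {0..2 * pi}"
      unfolding exp_x using c by simp
    from has_integral_diff[OF has_integral_diff[OF this x_int] has_integral_const_real[of 1 0 "2 * pi"]]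
    have "integral {0..2 * pi} (\<lambda>\<theta>. exp (x \<theta>) - x \<theta> - 1) = 0"
      by (simp add: integral_unique)
    moreover have "continuous_on {0..2 * pi} x"
    proof -
      have "continuous_on {0..2 * pi} (\<lambda>\<theta>. g (y \<theta>))"
        using y unfolding y_def
        by (intro continuous_on_compose2[OF holomorphic_on_imp_continuous_on[OF g(1)]] continuous_intros) auto
      then show ?thesis unfolding x_def by (intro continuous_intros)
    qed
    moreover have "0 \<le> exp (x \<theta>) - x \<theta> - 1" for \<theta> using exp_ge_add_one_self[of "x \<theta>"] by linarith
    ultimately have eq0: "exp (x \<theta>) - x \<theta> - 1 = 0" if "\<theta> \<in> {0..2 * pi}" for \<theta>
      using that by (subst (asm) integral_eq_0_iff) (auto intro!: continuous_intros)
    have "x \<theta> = 0" if "\<theta> \<in> {0..2 * pi}" for \<theta>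
      using ln_eq_minus_one[of "exp (x \<theta>)"] eq0[OF that] by simp
    moreover have "Arg2pi z \<in> {0..2 * pi}"
      using Arg2pi_ge_0[of z] Arg2pi_lt_2pi[of z] by (simp add: less_imp_le)
    moreover have "z = y (Arg2pi z)" using Arg2pi_eq[of z] by (simp add: y_def r_def)
    ultimately have "p * (Re (g z) - Re (g 0)) = 0" unfolding x_def by metis
    then have "Re (g z) = Re (g 0)" using p by simp
    then show ?thesis using g(2)[OF z] g(2)[of 0] \<delta> by simp
  qed simp
  moreover have "0 \<in> ball (0::complex) \<delta>" using \<delta>(1) by simp
  ultimately show ?thesis
    using maximum_modulus_principle[OF hol open_ball connected_ball open_ball \<delta>(2), of 0]
    by (metis order_refl)
qed

section \<open>The weight and integration by parts\<close>

text \<open>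
  The weight in the definition of the norm.
\<close>

definition weight :: "real \<Rightarrow> real \<Rightarrow> real" where
  "weight \<alpha> r = (1 - r\<^sup>2) powr (\<alpha> - 1)"

text \<open>
  The derivative of the weight on \<open>[0,1)\<close>, see \<open>DERIV_weight\<close> below.
\<close>

definition weight_deriv :: "real \<Rightarrow> real \<Rightarrow> real" where
  "weight_deriv \<alpha> r = 2 * (1 - \<alpha>) * r * (1 - r\<^sup>2) powr (\<alpha> - 2)"

text \<open>
  The \<open>p\<close>-th power of the norm with the integral truncated to \<open>(0,b)\<close>, written after an integration
  by parts so that the derivative of the mean no longer occurs.
\<close>

definition partial_energy :: "real \<Rightarrow> real \<Rightarrow> (complex \<Rightarrow> complex) \<Rightarrow> real \<Rightarrow> real" where
  "partial_energy \<alpha> p f b = integral_mean p f b * weight \<alpha> b -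
     integral {0..b} (\<lambda>s. integral_mean p f s * weight_deriv \<alpha> s)"

lemma one_minus_square_pos: "0 \<le> r \<Longrightarrow> r < 1 \<Longrightarrow> 0 < 1 - (r::real)\<^sup>2"
  by (simp add: abs_square_less_1)

lemma DERIV_weight:
  assumes "0 \<le> r" "r < 1"
  shows "(weight \<alpha> has_real_derivative weight_deriv \<alpha> r) (at r)"
proof -
  have inner: "((\<lambda>r. 1 - r\<^sup>2) has_real_derivative - 2 * r) (at r)"
    by (auto intro!: derivative_eq_intros)
  from DERIV_chain2[OF has_real_derivative_powr[OF one_minus_square_pos[OF assms]] inner, of "\<alpha> - 1"]
  show ?thesis unfolding weight_def[abs_def] weight_deriv_def by (simp add: algebra_simps)
qed

lemma weight_continuous: "continuous_on {0..<1} (weight \<alpha>)"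
  by (intro DERIV_continuous_on[where D="weight_deriv \<alpha>"])
     (auto intro: has_field_derivative_at_within DERIV_weight)

lemma weight_deriv_continuous: "continuous_on {0..<1} (weight_deriv \<alpha>)"
proof -
  have "1 - r\<^sup>2 \<noteq> 0" if "r \<in> {0..<1}" for r :: real
    using one_minus_square_pos[of r] that by simp
  then show ?thesis unfolding weight_deriv_def
    by (intro continuous_intros) blast
qed

lemma weight_pos: "0 \<le> r \<Longrightarrow> r < 1 \<Longrightarrow> 0 < weight \<alpha> r"
  using one_minus_square_pos[of r] by (simp add: weight_def)

lemma weight_deriv_nonneg: "\<alpha> < 1 \<Longrightarrow> 0 \<le> r \<Longrightarrow> 0 \<le> weight_deriv \<alpha> r"
  by (simp add: weight_deriv_def)

lemma weight_0 [simp]: "weight \<alpha> 0 = 1"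
  by (simp add: weight_def)

lemma integral_weight_deriv:
  assumes "0 \<le> b" "b < 1"
  shows "(weight_deriv \<alpha> has_integral (weight \<alpha> b - 1)) {0..b}"
proof -
  have "(weight_deriv \<alpha> has_integral (weight \<alpha> b - weight \<alpha> 0)) {0..b}"
  proof (rule fundamental_theorem_of_calculus[OF assms(1)])
    fix r assume "r \<in> {0..b}"
    then have "(weight \<alpha> has_real_derivative weight_deriv \<alpha> r) (at r)"
      using assms by (intro DERIV_weight) auto
    then show "(weight \<alpha> has_vector_derivative weight_deriv \<alpha> r) (at r within {0..b})"
      unfolding has_real_derivative_iff_has_vector_derivative[symmetric]
      by (rule has_field_derivative_at_within)
  qed
  then show ?thesis by simp
qed

lemma mean_times_weight_deriv_integrable:
  assumes "f holomorphic_on ball 0 1" "0 < p" "b < 1"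
  shows "(\<lambda>s. integral_mean p f s * weight_deriv \<alpha> s) integrable_on {0..b}"
  using assms by (intro integrable_continuous_interval continuous_on_mult
      continuous_on_subset[OF integral_mean_continuous] continuous_on_subset[OF weight_deriv_continuous]) auto

text \<open>
  The maximum with 0 matches the truncation in \<open>ennreal\<close>. It matters at most at the finitely many
  exceptional radii and at the end points, where \<open>deriv\<close> may be an arbitrary value.
\<close>

lemma partial_energy_has_integral:
  assumes hol: "f holomorphic_on ball 0 1" and p: "0 < p" and b: "0 \<le> b" "b < 1"
  shows "((\<lambda>r. max 0 (deriv (integral_mean p f) r * weight \<alpha> r)) has_integral
    (partial_energy \<alpha> p f b - norm (f 0) powr p)) {0..b}"
proof -
  let ?M = "integral_mean p f"
  obtain E where E: "finite E"
    "\<And>r. r \<in> {0<..<b} - E \<Longrightarrow> (?M has_real_derivative deriv ?M r) (at r)"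
    using integral_mean_differentiable_cofinite[OF hol p b(2)] by blast
  have "((\<lambda>r. deriv ?M r * weight \<alpha> r + weight_deriv \<alpha> r * ?M r) has_integral
      ?M b * weight \<alpha> b - ?M 0 * weight \<alpha> 0) {0..b}"
  proof (rule fundamental_theorem_of_calculus_interior_strong[OF E(1) b(1)])
    show "continuous_on {0..b} (\<lambda>r. ?M r * weight \<alpha> r)"
      using b by (intro continuous_on_mult continuous_on_subset[OF integral_mean_continuous[OF hol p]]
          continuous_on_subset[OF weight_continuous]) auto
    fix r assume r: "r \<in> {0<..<b} - E"
    then show "((\<lambda>r. ?M r * weight \<alpha> r) has_vector_derivative
        deriv ?M r * weight \<alpha> r + weight_deriv \<alpha> r * ?M r) (at r)"
      unfolding has_real_derivative_iff_has_vector_derivative[symmetric]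
      using b by (intro DERIV_mult E(2) DERIV_weight) auto
  qed
  from has_integral_diff[OF this integrable_integral[OF mean_times_weight_deriv_integrable[OF hol p b(2), of \<alpha>]]]
  have int: "((\<lambda>r. deriv ?M r * weight \<alpha> r) has_integral partial_energy \<alpha> p f b - norm (f 0) powr p) {0..b}"
    using integral_mean_0[OF hol p] by (simp add: partial_energy_def algebra_simps)
  have max_eq: "max 0 (deriv ?M r * weight \<alpha> r) = deriv ?M r * weight \<alpha> r"
    if r: "r \<in> {0..b} - (insert 0 (insert b E))" for r
  proof -
    have r': "r \<in> {0<..<b} - E" using r by auto
    have "deriv ?M r \<ge> 0"
    proof (rule mono_on_imp_deriv_nonneg[OF integral_mean_mono_on[OF hol p] E(2)[OF r']])
      show "r \<in> interior {0..<1}" using r' b by simp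
    qed
    moreover have "weight \<alpha> r \<ge> 0" using weight_pos[of r \<alpha>] r' b by simp
    ultimately show ?thesis by (simp add: max_absorb2)
  qed
  have fin: "finite (insert 0 (insert b E))" using E(1) by simp
  show ?thesis
    by (rule has_integral_spike_finite[OF fin max_eq int])
qed

lemma has_integral_Ioo_iff_Icc:
  fixes f :: "real \<Rightarrow> 'a::banach"
  shows "(f has_integral I) {a<..<b} \<longleftrightarrow> (f has_integral I) {a..b}"
  using has_integral_open_interval[of f I a b] by (simp add: box_real)

lemma partial_energy_nn_integral:
  assumes hol: "f holomorphic_on ball 0 1" and p: "0 < p" and b: "0 \<le> b" "b < 1"
  shows "ennreal (partial_energy \<alpha> p f b) = ennreal (norm (f 0) powr p) +
    (\<integral>\<^sup>+ r\<in>{0<..<b}. ennreal (deriv (integral_mean p f) r * weight \<alpha> r) \<partial>lborel)"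
proof -
  let ?I = "partial_energy \<alpha> p f b - norm (f 0) powr p"
  have I: "((\<lambda>r. max 0 (deriv (integral_mean p f) r * weight \<alpha> r)) has_integral ?I) {0<..<b}"
    unfolding has_integral_Ioo_iff_Icc by (rule partial_energy_has_integral[OF assms])
  have "?I \<ge> 0" using I by (rule has_integral_nonneg) auto
  moreover have "(\<integral>\<^sup>+ r\<in>{0<..<b}. ennreal (deriv (integral_mean p f) r * weight \<alpha> r) \<partial>lborel) = ennreal ?I"
    using nn_integral_has_integral_lebesgue'[OF _ I] by (simp add: ennreal_max_0)
  ultimately show ?thesis by (simp add: ennreal_plus[symmetric] del: ennreal_plus)
qed

lemma partial_energy_le_powp:
  assumes "f holomorphic_on ball 0 1" "0 < p" "0 \<le> b" "b < 1"
  shows "ennreal (partial_energy \<alpha> p f b) \<le> weighted_norm_powp \<alpha> p f"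
  unfolding partial_energy_nn_integral[OF assms] weighted_norm_powp_def weight_def
  using assms(4) by (intro add_left_mono nn_integral_mono) (auto simp: indicator_def)

lemma partial_energy_ge_mean:
  assumes hol: "f holomorphic_on ball 0 1" and p: "0 < p" and b: "0 \<le> b" "b < 1" and \<alpha>: "\<alpha> < 1"
  shows "integral_mean p f b \<le> partial_energy \<alpha> p f b"
proof -
  let ?M = "integral_mean p f"
  have "integral {0..b} (\<lambda>s. ?M s * weight_deriv \<alpha> s) \<le> ?M b * (weight \<alpha> b - 1)"
    by (rule has_integral_le[OF integrable_integral[OF mean_times_weight_deriv_integrable[OF hol p b(2)]]
        has_integral_mult_right[OF integral_weight_deriv[OF b]]])
      (use b \<alpha> in \<open>auto intro!: mult_right_mono weight_deriv_nonneg mono_onD[OF integral_mean_mono_on[OF hol p]]\<close>)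
  then show ?thesis by (simp add: partial_energy_def algebra_simps)
qed

text \<open>
  An increasing sequence of radii in \<open>(0,1)\<close> with limit 1; nothing but this is used of it.
\<close>

definition radius_seq :: "nat \<Rightarrow> real" where
  "radius_seq n = 1 - 1 / (real n + 2)"

lemma radius_seq_bounds: "0 < radius_seq n" "radius_seq n < 1"
  by (auto simp: radius_seq_def field_simps)

lemma incseq_radius_seq: "incseq radius_seq"
  by (auto simp: radius_seq_def incseq_def intro!: divide_left_mono)

lemma radius_seq_LIMSEQ: "radius_seq \<longlonglongrightarrow> 1"
  unfolding radius_seq_def by real_asymp

lemma eventually_less_radius_seq: "r < 1 \<Longrightarrow> eventually (\<lambda>n. r < radius_seq n) sequentially"
  using order_tendstoD(1)[OF radius_seq_LIMSEQ] .

text \<open>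
  Monotone convergence as the truncation radius tends to 1. It is applied to the completed measure,
  where measurability of the derivative comes from Henstock-Kurzweil integrability.
\<close>

lemma partial_energy_LIMSEQ:
  assumes hol: "f holomorphic_on ball 0 1" and p: "0 < p"
  shows "(\<lambda>n. ennreal (partial_energy \<alpha> p f (radius_seq n))) \<longlonglongrightarrow> weighted_norm_powp \<alpha> p f"
proof -
  let ?h = "\<lambda>r. max 0 (deriv (integral_mean p f) r * weight \<alpha> r)"
  let ?b = radius_seq
  define F where "F = (\<lambda>n r. ennreal (?h r) * indicator {0<..<?b n} r)"
  have meas: "F n \<in> borel_measurable lebesgue" for n
  proof -
    have "(?h has_integral (partial_energy \<alpha> p f (?b n) - norm (f 0) powr p)) {0<..<?b n}"
      unfolding has_integral_Ioo_iff_Icc using radius_seq_bounds[of n]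
      by (intro partial_energy_has_integral hol p) auto
    from has_integral_implies_lebesgue_measurable[OF this]
    have "(\<lambda>r. ennreal (indicator {0<..<?b n} r *\<^sub>R ?h r)) \<in> borel_measurable lebesgue"
      by measurable
    also have "(\<lambda>r. ennreal (indicator {0<..<?b n} r *\<^sub>R ?h r)) = F n"
      by (auto simp: F_def indicator_def)
    finally show ?thesis .
  qed
  have "(\<lambda>n. integral\<^sup>N lebesgue (F n)) \<longlonglongrightarrow> (\<integral>\<^sup>+ r\<in>{0<..<1}. ennreal (?h r) \<partial>lebesgue)"
  proof (rule nn_integral_LIMSEQ[OF _ meas])
    show "incseq F"
      using incseqD[OF incseq_radius_seq] unfolding F_def incseq_def le_fun_def
      by (fastforce simp: indicator_def intro: order_less_le_trans)
    show "(\<lambda>n. F n r) \<longlonglongrightarrow> ennreal (?h r) * indicator {0<..<1} r" for r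
    proof (cases "r \<in> {0<..<1}")
      case True
      then show ?thesis
        by (intro tendsto_eventually eventually_mono[OF eventually_less_radius_seq[of r]]) (auto simp: F_def)
    next
      case False
      then have "F n r = 0" for n using radius_seq_bounds[of n] by (auto simp: F_def indicator_def)
      then show ?thesis using False by simp
    qed
  qed
  then have "(\<lambda>n. ennreal (norm (f 0) powr p) + integral\<^sup>N lborel (F n)) \<longlonglongrightarrow>
      ennreal (norm (f 0) powr p) + (\<integral>\<^sup>+ r\<in>{0<..<1}. ennreal (?h r) \<partial>lborel)"
    unfolding nn_integral_completion by (intro tendsto_add tendsto_const)
  then show ?thesis
    unfolding F_def weighted_norm_powp_def
    using partial_energy_nn_integral[OF hol p] radius_seq_bounds
    by (simp add: ennreal_max_0 weight_def less_imp_le)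
qed

section \<open>The increase of the norm under the shift\<close>

text \<open>
  The density against which the integral mean of \<open>f\<close> is integrated to give the increase of the
  \<open>p\<close>-th power of the norm under the shift.
\<close>

definition gain :: "real \<Rightarrow> real \<Rightarrow> real \<Rightarrow> real" where
  "gain \<alpha> p s = (1 - s powr p) * weight_deriv \<alpha> s"

lemma gain_0 [simp]: "gain \<alpha> p 0 = 0"
  by (simp add: gain_def weight_deriv_def)

lemma gain_pos:
  assumes "\<alpha> < 1" "0 < p" "0 < s" "s < 1"
  shows "0 < gain \<alpha> p s"
proof -
  have "s powr p < 1" using assms powr_less_mono2[of p s 1] by simp
  moreover have "weight_deriv \<alpha> s > 0"
    using assms one_minus_square_pos[of s] by (simp add: weight_deriv_def)
  ultimately show ?thesis by (simp add: gain_def)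
qed

lemma gain_nonneg: "\<alpha> < 1 \<Longrightarrow> 0 < p \<Longrightarrow> 0 \<le> s \<Longrightarrow> s < 1 \<Longrightarrow> 0 \<le> gain \<alpha> p s"
  using gain_pos[of \<alpha> p s] by (cases "s = 0") auto

lemma gain_continuous:
  assumes "0 < p"
  shows "continuous_on {0..<1} (gain \<alpha> p)"
proof -
  have "continuous_on {0..<1} (\<lambda>s::real. s powr p)"
    using assms by (intro continuous_on_powr') (auto intro!: continuous_intros)
  then show ?thesis unfolding gain_def
    by (intro continuous_on_mult continuous_on_diff continuous_on_const weight_deriv_continuous)
qed

text \<open>
  Bernoulli's inequality for \<open>(s\<^sup>2)^n\<close>, where \<open>p \<le> 2n\<close>. This bound supplies one factor \<open>1 - s\<^sup>2\<close>, which
  makes \<open>gain\<close> integrable and the boundary term at \<open>s = 1\<close> vanish.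
\<close>

lemma one_minus_powr_le:
  fixes p :: real
  assumes "0 < p"
  obtains n :: nat where "\<And>s. 0 \<le> s \<Longrightarrow> s \<le> 1 \<Longrightarrow> 1 - s powr p \<le> real n * (1 - s\<^sup>2)"
proof -
  obtain n :: nat where n: "p \<le> 2 * real n"
    using real_arch_simple[of "p / 2"] by (auto simp: field_simps)
  then have "0 < real n" using assms by linarith
  then have n1: "1 \<le> real n" by simp
  have "1 - s powr p \<le> real n * (1 - s\<^sup>2)" if s: "0 \<le> s" "s \<le> 1" for s
  proof (cases "s = 0")
    case False
    then have s0: "0 < s" using s by simp
    have "1 + real n * (s\<^sup>2 - 1) \<le> (1 + (s\<^sup>2 - 1)) ^ n"
      by (rule Bernoulli_inequality) simp
    also have "\<dots> = s powr (2 * real n)"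
      using powr_realpow[OF s0, of "2 * n"] by (simp add: power_mult)
    also have "\<dots> \<le> s powr p" using n s by (intro powr_mono') auto
    finally show ?thesis by (simp add: algebra_simps)
  qed (use n1 in simp)
  then show thesis using that by metis
qed

lemma set_integrable_Ioo:
  fixes g :: "real \<Rightarrow> real"
  assumes cont: "continuous_on {a<..<b} g" and nonneg: "\<And>x. x \<in> {a<..<b} \<Longrightarrow> 0 \<le> g x"
    and int: "(g has_integral I) {a<..<b}"
  shows "set_integrable lborel {a<..<b} g"
  unfolding set_integrable_def
proof (rule integrableI_nonneg)
  show "(\<lambda>x. indicator {a<..<b} x *\<^sub>R g x) \<in> borel_measurable lborel"
    using borel_measurable_continuous_on_indicator[OF _ cont] by simp
  show "AE x in lborel. 0 \<le> indicator {a<..<b} x *\<^sub>R g x"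
    using nonneg by (auto simp: indicator_def)
  have "(\<integral>\<^sup>+ x. ennreal (indicator {a<..<b} x *\<^sub>R g x) \<partial>lborel) = (\<integral>\<^sup>+ x. ennreal (g x) * indicator {a<..<b} x \<partial>lborel)"
    by (intro nn_integral_cong) (auto simp: indicator_def)
  also have "\<dots> = ennreal I" by (rule nn_integral_has_integral_lebesgue'[OF nonneg int])
  finally show "(\<integral>\<^sup>+ x. ennreal (indicator {a<..<b} x *\<^sub>R g x) \<partial>lborel) < \<infinity>" by simp
qed

lemma set_integrable_gain:
  assumes \<alpha>: "0 < \<alpha>" "\<alpha> < 1" and p: "0 < p"
  shows "set_integrable lborel {0<..<1} (gain \<alpha> p)"
proof -
  obtain n :: nat where n: "\<And>s. 0 \<le> s \<Longrightarrow> s \<le> 1 \<Longrightarrow> 1 - s powr p \<le> real n * (1 - s\<^sup>2)"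
    using one_minus_powr_le[OF p] by blast
  \<comment> \<open>the constant that makes the majorant \<open>g\<close> the exact derivative of \<open>G\<close>\<close>
  define c where "c = real n * (1 - \<alpha>) / \<alpha>"
  define g where "g = (\<lambda>s. c * (\<alpha> * (1 - s\<^sup>2) powr (\<alpha> - 1) * (2 * s)))"
  define G where "G = (\<lambda>s::real. - c * (1 - s\<^sup>2) powr \<alpha>)"
  have c: "c \<ge> 0" using \<alpha> by (simp add: c_def)
  have "(g has_integral G 1 - G 0) {0..1}"
  proof (rule fundamental_theorem_of_calculus_interior)
    show "continuous_on {0..1} G"
      unfolding G_def using \<alpha> by (intro continuous_on_mult continuous_on_const continuous_on_powr')
        (auto intro!: continuous_intros simp: power_le_one)
    fix s :: real assume s: "s \<in> {0<..<1}"
    have inner: "((\<lambda>r. 1 - r\<^sup>2) has_real_derivative - (2 * s)) (at s)"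
      by (auto intro!: derivative_eq_intros)
    have "((\<lambda>r. (1 - r\<^sup>2) powr \<alpha>) has_real_derivative \<alpha> * (1 - s\<^sup>2) powr (\<alpha> - 1) * - (2 * s)) (at s)"
      using s by (intro DERIV_chain2[OF has_real_derivative_powr[OF one_minus_square_pos] inner]) auto
    from DERIV_cmult[OF this, of "- c"]
    show "(G has_vector_derivative g s) (at s)"
      unfolding has_real_derivative_iff_has_vector_derivative[symmetric] G_def g_def by simp
  qed simp
  then have g_int: "(g has_integral G 1 - G 0) {0<..<1}"
    unfolding has_integral_Ioo_iff_Icc .
  have contg: "continuous_on {0<..<1} g"
  proof -
    have "1 - s\<^sup>2 \<noteq> 0" if "s \<in> {0<..<1}" for s :: real
      using one_minus_square_pos[of s] that by simp
    then show ?thesis unfolding g_def by (intro continuous_intros) blast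
  qed
  have g_set: "set_integrable lborel {0<..<1} g"
    by (rule set_integrable_Ioo[OF contg _ g_int]) (use c \<alpha> in \<open>simp add: g_def\<close>)
  show ?thesis
  proof (rule set_integrable_bound[OF g_set])
    have "continuous_on {0<..<1} (gain \<alpha> p)"
      by (rule continuous_on_subset[OF gain_continuous[OF p]]) auto
    then show "set_borel_measurable lborel {0<..<1} (gain \<alpha> p)"
      unfolding set_borel_measurable_def
      using borel_measurable_continuous_on_indicator[of "{0<..<1}" "gain \<alpha> p"] by simp
    show "AE s in lborel. s \<in> {0<..<1} \<longrightarrow> norm (gain \<alpha> p s) \<le> norm (g s)"
    proof (intro AE_I2 impI)
      fix s :: real assume s: "s \<in> {0<..<1}"
      then have pos: "1 - s\<^sup>2 > 0" by (intro one_minus_square_pos) auto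
      have "gain \<alpha> p s \<le> (real n * (1 - s\<^sup>2)) * weight_deriv \<alpha> s"
        unfolding gain_def using s n[of s] weight_deriv_nonneg[OF \<alpha>(2), of s]
        by (intro mult_right_mono) auto
      also have "\<dots> = (real n * (1 - \<alpha>)) * (2 * s) * ((1 - s\<^sup>2) * (1 - s\<^sup>2) powr (\<alpha> - 2))"
        by (simp add: weight_deriv_def)
      also have "(1 - s\<^sup>2) * (1 - s\<^sup>2) powr (\<alpha> - 2) = (1 - s\<^sup>2) powr (\<alpha> - 1)"
        using pos powr_mult_base[of "1 - s\<^sup>2" "\<alpha> - 2"] by simp
      also have "real n * (1 - \<alpha>) * (2 * s) * (1 - s\<^sup>2) powr (\<alpha> - 1) = g s"
        using \<alpha> by (simp add: g_def c_def)
      finally show "norm (gain \<alpha> p s) \<le> norm (g s)"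
        using gain_nonneg[OF \<alpha>(2) p, of s] s by simp
    qed
  qed
qed

lemma set_integrable_mult_gain:
  assumes \<alpha>: "0 < \<alpha>" "\<alpha> < 1" and p: "0 < p"
    and h: "continuous_on {0<..<1} h" "\<And>s. s \<in> {0<..<1} \<Longrightarrow> \<bar>h s\<bar> \<le> C"
  shows "set_integrable lborel {0<..<1} (\<lambda>s. h s * gain \<alpha> p s)"
proof (rule set_integrable_bound)
  show "set_integrable lborel {0<..<1} (\<lambda>s. C * gain \<alpha> p s)"
    using set_integrable_gain[OF \<alpha> p] by simp
  have "continuous_on {0<..<1} (\<lambda>s. h s * gain \<alpha> p s)"
    by (intro continuous_on_mult h continuous_on_subset[OF gain_continuous[OF p]]) auto
  then show "set_borel_measurable lborel {0<..<1} (\<lambda>s. h s * gain \<alpha> p s)"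
    unfolding set_borel_measurable_def
    using borel_measurable_continuous_on_indicator[of "{0<..<1}" "\<lambda>s. h s * gain \<alpha> p s"] by simp
  show "AE s in lborel. s \<in> {0<..<1} \<longrightarrow> norm (h s * gain \<alpha> p s) \<le> norm (C * gain \<alpha> p s)"
  proof (intro AE_I2 impI)
    fix s :: real assume s: "s \<in> {0<..<1}"
    have "\<bar>h s\<bar> \<le> \<bar>C\<bar>" using h(2)[OF s] by linarith
    then show "norm (h s * gain \<alpha> p s) \<le> norm (C * gain \<alpha> p s)"
      by (simp add: abs_mult mult_right_mono)
  qed
qed

text \<open>
  A positive density and a continuous integrand: a vanishing integral forces the integrand to
  vanish. Used for the strictness of the expansion and for the case of equality.
\<close>

lemma gain_integral_eq_0_imp:
  assumes \<alpha>: "0 < \<alpha>" "\<alpha> < 1" and p: "0 < p"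
    and h: "continuous_on {0<..<1} h" "\<And>s. s \<in> {0<..<1} \<Longrightarrow> 0 \<le> h s" "\<And>s. s \<in> {0<..<1} \<Longrightarrow> h s \<le> C"
    and zero: "(LBINT s:{0<..<1}. h s * gain \<alpha> p s) \<le> 0" and s: "s \<in> {0<..<1}"
  shows "h s = 0"
proof -
  define a b where "a = s / 2" and "b = (s + 1) / 2"
  have ab: "0 < a" "a < s" "s < b" "b < 1" using s by (auto simp: a_def b_def)
  let ?F = "\<lambda>s. h s * gain \<alpha> p s"
  have F0: "0 \<le> ?F s" if "s \<in> {0<..<1}" for s
    using h(2)[OF that] gain_nonneg[OF \<alpha>(2) p, of s] that by auto
  have F: "set_integrable lborel {0<..<1} ?F"
    using h by (intro set_integrable_mult_gain[OF \<alpha> p, of h C]) (auto simp: abs_le_iff intro: order.trans)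
  have contF: "continuous_on {a..b} ?F"
    using ab by (intro continuous_on_mult continuous_on_subset[OF h(1)] continuous_on_subset[OF gain_continuous[OF p]]) auto
  then have Fab: "set_integrable lborel {a..b} ?F"
    by (rule borel_integrable_atLeastAtMost')
  have "integral {a..b} ?F = (LBINT s:{a..b}. ?F s)"
    using set_borel_integral_eq_integral(2)[OF Fab] by simp
  also have "\<dots> \<le> (LBINT s:{0<..<1}. ?F s)"
    using F Fab ab F0 unfolding set_integrable_def set_lebesgue_integral_def
    by (intro integral_mono) (auto simp: indicator_def)
  finally have "integral {a..b} ?F \<le> 0" using zero by simp
  moreover have "0 \<le> integral {a..b} ?F"
    using ab F0 by (intro integral_nonneg integrable_continuous_interval contF) auto
  ultimately have "integral {a..b} ?F = 0" by simp
  moreover have "integral {a..b} ?F = 0 \<longleftrightarrow> (\<forall>s\<in>{a..b}. ?F s = 0)"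
    using ab F0 by (intro integral_eq_0_iff contF) auto
  ultimately have "?F s = 0" using ab by auto
  then show ?thesis using gain_pos[OF \<alpha>(2) p, of s] s by auto
qed

lemma boundary_term_LIMSEQ:
  assumes \<alpha>: "0 < \<alpha>" and p: "0 < p"
  shows "(\<lambda>n. (1 - radius_seq n powr p) * weight \<alpha> (radius_seq n)) \<longlonglongrightarrow> 0"
proof -
  obtain m :: nat where m: "\<And>s. 0 \<le> s \<Longrightarrow> s \<le> 1 \<Longrightarrow> 1 - s powr p \<le> real m * (1 - s\<^sup>2)"
    using one_minus_powr_le[OF p] by blast
  have "(\<lambda>n. 1 - (radius_seq n)\<^sup>2) \<longlonglongrightarrow> 1 - 1\<^sup>2"
    by (intro tendsto_intros radius_seq_LIMSEQ)
  then have "(\<lambda>n. real m * (1 - (radius_seq n)\<^sup>2) powr \<alpha>) \<longlonglongrightarrow> real m * 0 powr \<alpha>"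
    using \<alpha> radius_seq_bounds
    by (intro tendsto_mult tendsto_const tendsto_powr') (auto intro!: always_eventually simp: power_le_one less_imp_le)
  then have lim: "(\<lambda>n. real m * (1 - (radius_seq n)\<^sup>2) powr \<alpha>) \<longlonglongrightarrow> 0"
    by simp
  show ?thesis
  proof (rule tendsto_sandwich[OF always_eventually always_eventually tendsto_const lim]; intro allI)
    fix n
    let ?b = "radius_seq n"
    have b: "0 < ?b" "?b < 1" by (rule radius_seq_bounds)+
    then have pos: "1 - ?b\<^sup>2 > 0" by (intro one_minus_square_pos) auto
    have "?b powr p \<le> 1" using b p powr_mono2[of p ?b 1] by simp
    then show "0 \<le> (1 - ?b powr p) * weight \<alpha> ?b"
      using weight_pos[of ?b \<alpha>] b by simp
    have "(1 - ?b powr p) * weight \<alpha> ?b \<le> (real m * (1 - ?b\<^sup>2)) * weight \<alpha> ?b"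
      using m[of ?b] b weight_pos[of ?b \<alpha>] by (intro mult_right_mono) auto
    also have "\<dots> = real m * ((1 - ?b\<^sup>2) * (1 - ?b\<^sup>2) powr (\<alpha> - 1))"
      by (simp add: weight_def)
    also have "(1 - ?b\<^sup>2) * (1 - ?b\<^sup>2) powr (\<alpha> - 1) = (1 - ?b\<^sup>2) powr \<alpha>"
      using pos powr_mult_base[of "1 - ?b\<^sup>2" "\<alpha> - 1"] by simp
    finally show "(1 - ?b powr p) * weight \<alpha> ?b \<le> real m * (1 - ?b\<^sup>2) powr \<alpha>" .
  qed
qed

lemma integral_mean_shift:
  assumes "f holomorphic_on ball 0 1" "0 < p" "0 \<le> r" "r < 1"
  shows "integral_mean p (shift f) r = r powr p * integral_mean p f r"
proof -
  have "shift f holomorphic_on ball 0 1"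
    unfolding shift_def using assms by (intro holomorphic_intros)
  then show ?thesis
    using assms by (simp add: integral_mean_eq shift_def norm_mult powr_mult)
qed

lemma partial_energy_shift:
  assumes hol: "f holomorphic_on ball 0 1" and p: "0 < p" and b: "0 \<le> b" "b < 1"
  shows "partial_energy \<alpha> p (shift f) b = partial_energy \<alpha> p f b
     + integral {0..b} (\<lambda>s. integral_mean p f s * gain \<alpha> p s)
     - integral_mean p f b * ((1 - b powr p) * weight \<alpha> b)"
proof -
  let ?M = "integral_mean p f"
  have int: "(\<lambda>s. ?M s * gain \<alpha> p s) integrable_on {0..b}"
    using b by (intro integrable_continuous_interval continuous_on_mult continuous_on_subset[OF integral_mean_continuous[OF hol p]]
      continuous_on_subset[OF gain_continuous[OF p]]) auto
  have "integral {0..b} (\<lambda>s. integral_mean p (shift f) s * weight_deriv \<alpha> s) =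
     integral {0..b} (\<lambda>s. ?M s * weight_deriv \<alpha> s - ?M s * gain \<alpha> p s)"
    using b by (intro integral_cong) (simp add: integral_mean_shift[OF hol p] gain_def algebra_simps)
  also have "\<dots> = integral {0..b} (\<lambda>s. ?M s * weight_deriv \<alpha> s) - integral {0..b} (\<lambda>s. ?M s * gain \<alpha> p s)"
    by (intro integral_diff int mean_times_weight_deriv_integrable[OF hol p b(2)])
  finally show ?thesis
    using integral_mean_shift[OF hol p b] by (simp add: partial_energy_def algebra_simps)
qed

lemma mean_gain_integral_LIMSEQ:
  assumes hol: "f holomorphic_on ball 0 1" and p: "0 < p" and \<alpha>: "0 < \<alpha>" "\<alpha> < 1"
    and bound: "\<And>s. s \<in> {0<..<1} \<Longrightarrow> integral_mean p f s \<le> C"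
  shows "(\<lambda>n. integral {0..radius_seq n} (\<lambda>s. integral_mean p f s * gain \<alpha> p s)) \<longlonglongrightarrow>
    (LBINT s:{0<..<1}. integral_mean p f s * gain \<alpha> p s)"
proof -
  let ?F = "\<lambda>s. integral_mean p f s * gain \<alpha> p s"
  have cont: "continuous_on {0..<1} ?F"
    by (intro continuous_on_mult integral_mean_continuous hol p gain_continuous)
  have F: "set_integrable lborel {0<..<1} ?F"
    using bound integral_mean_nonneg[of p f]
    by (intro set_integrable_mult_gain[OF \<alpha> p] continuous_on_subset[OF integral_mean_continuous[OF hol p]]) auto
  have Fn: "set_integrable lborel {0..radius_seq n} ?F" for n
    using radius_seq_bounds[of n]
    by (intro borel_integrable_atLeastAtMost' continuous_on_subset[OF cont]) auto
  have "(\<lambda>n. LBINT s:{0..radius_seq n}. ?F s) \<longlonglongrightarrow> (LBINT s:{0<..<1}. ?F s)"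
    unfolding set_lebesgue_integral_def
  proof (rule integral_dominated_convergence[where w="\<lambda>s. indicator {0<..<1} s *\<^sub>R ?F s"])
    show "(\<lambda>s. indicator {0<..<1} s *\<^sub>R ?F s) \<in> borel_measurable lborel"
      using F unfolding set_integrable_def by (rule borel_measurable_integrable)
    show "integrable lborel (\<lambda>s. indicator {0<..<1} s *\<^sub>R ?F s)"
      using F unfolding set_integrable_def .
    show "(\<lambda>s. indicator {0..radius_seq n} s *\<^sub>R ?F s) \<in> borel_measurable lborel" for n
      using Fn[of n] unfolding set_integrable_def by (rule borel_measurable_integrable)
    show "AE s in lborel. (\<lambda>n. indicator {0..radius_seq n} s *\<^sub>R ?F s) \<longlonglongrightarrow> indicator {0<..<1} s *\<^sub>R ?F s"
    proof (rule AE_I2)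
      fix s :: real
      show "(\<lambda>n. indicator {0..radius_seq n} s *\<^sub>R ?F s) \<longlonglongrightarrow> indicator {0<..<1} s *\<^sub>R ?F s"
      proof (cases "s \<in> {0<..<1}")
        case True
        then have "s < 1" by simp
        show ?thesis
          by (rule tendsto_eventually, rule eventually_mono[OF eventually_less_radius_seq[OF \<open>s < 1\<close>]])
            (use True in \<open>simp add: indicator_def\<close>)
      next
        case False
        then have "indicator {0..radius_seq n} s *\<^sub>R ?F s = indicator {0<..<1} s *\<^sub>R ?F s" for n
          using radius_seq_bounds[of n] by (cases "s = 0") (auto simp: indicator_def)
        then show ?thesis by (simp only: tendsto_const)
      qed
    qed
    show "AE s in lborel. norm (indicator {0..radius_seq n} s *\<^sub>R ?F s) \<le> indicator {0<..<1} s *\<^sub>R ?F s" for n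
    proof (rule AE_I2)
      fix s :: real
      have nn: "0 \<le> ?F s" if "0 \<le> s" "s < 1"
        using gain_nonneg[OF \<alpha>(2) p that] integral_mean_nonneg[of p f s] by simp
      show "norm (indicator {0..radius_seq n} s *\<^sub>R ?F s) \<le> indicator {0<..<1} s *\<^sub>R ?F s"
        using nn radius_seq_bounds[of n] by (cases "s = 0") (auto simp: indicator_def)
    qed
  qed
  then show ?thesis using set_borel_integral_eq_integral(2)[OF Fn] by simp
qed

text \<open>
  The \<open>p\<close>-th power of the norm as a real number; like the norm, it is meaningful only for functions
  in \<open>weighted_space \<alpha> p\<close>.
\<close>

definition energy :: "real \<Rightarrow> real \<Rightarrow> (complex \<Rightarrow> complex) \<Rightarrow> real" where
  "energy \<alpha> p f = enn2real (weighted_norm_powp \<alpha> p f)"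

lemma energy_nonneg: "0 \<le> energy \<alpha> p f"
  by (simp add: energy_def)

lemma weighted_norm_eq: "weighted_norm \<alpha> p f = energy \<alpha> p f powr (1 / p)"
  by (simp add: weighted_norm_def energy_def)

lemma weighted_norm_powp_eq_energy:
  "f \<in> weighted_space \<alpha> p \<Longrightarrow> weighted_norm_powp \<alpha> p f = ennreal (energy \<alpha> p f)"
  by (simp add: weighted_space_def energy_def less_top)

lemma energy_eqI:
  assumes hol: "f holomorphic_on ball 0 1" and p: "0 < p" and E: "0 \<le> E"
    and lim: "(\<lambda>n. partial_energy \<alpha> p f (radius_seq n)) \<longlonglongrightarrow> E"
  shows "f \<in> weighted_space \<alpha> p" "energy \<alpha> p f = E"
proof -
  have "weighted_norm_powp \<alpha> p f = ennreal E"
    using LIMSEQ_unique[OF partial_energy_LIMSEQ[OF hol p] tendsto_ennrealI[OF lim]] .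
  then show "f \<in> weighted_space \<alpha> p" "energy \<alpha> p f = E"
    using E hol by (simp_all add: weighted_space_def energy_def)
qed

lemma partial_energy_nonneg:
  assumes "f holomorphic_on ball 0 1" "0 < p" "0 \<le> b" "b < 1" "\<alpha> < 1"
  shows "0 \<le> partial_energy \<alpha> p f b"
  using partial_energy_ge_mean[OF assms] integral_mean_nonneg[of p f b] by linarith

lemma partial_energy_LIMSEQ_energy:
  assumes f: "f \<in> weighted_space \<alpha> p" and p: "0 < p" and \<alpha>: "\<alpha> < 1"
  shows "(\<lambda>n. partial_energy \<alpha> p f (radius_seq n)) \<longlonglongrightarrow> energy \<alpha> p f"
proof (rule tendsto_ennrealD)
  have hol: "f holomorphic_on ball 0 1" using f by (simp add: weighted_space_def)
  show "(\<lambda>n. ennreal (partial_energy \<alpha> p f (radius_seq n))) \<longlonglongrightarrow> ennreal (energy \<alpha> p f)"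
    using partial_energy_LIMSEQ[OF hol p, of \<alpha>] weighted_norm_powp_eq_energy[OF f] by simp
  show "\<forall>\<^sub>F n in sequentially. 0 \<le> partial_energy \<alpha> p f (radius_seq n)"
    using partial_energy_nonneg[OF hol p _ _ \<alpha>] radius_seq_bounds
    by (intro always_eventually allI) (simp add: less_imp_le)
qed (rule energy_nonneg)

lemma integral_mean_le_energy:
  assumes f: "f \<in> weighted_space \<alpha> p" and p: "0 < p" and \<alpha>: "\<alpha> < 1" and s: "0 \<le> s" "s < 1"
  shows "integral_mean p f s \<le> energy \<alpha> p f"
proof -
  have hol: "f holomorphic_on ball 0 1" using f by (simp add: weighted_space_def)
  have "ennreal (partial_energy \<alpha> p f s) \<le> ennreal (energy \<alpha> p f)"
    using partial_energy_le_powp[OF hol p s, of \<alpha>] weighted_norm_powp_eq_energy[OF f] by simp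
  then have "partial_energy \<alpha> p f s \<le> energy \<alpha> p f"
    using energy_nonneg[of \<alpha> p f] by (simp add: ennreal_le_iff)
  then show ?thesis using partial_energy_ge_mean[OF hol p s \<alpha>] by simp
qed

text \<open>
  The identity that carries the theorem: the shift increases the \<open>p\<close>-th power of the norm by the
  integral of the mean against \<open>gain\<close>.
\<close>

lemma shift_energy:
  assumes f: "f \<in> weighted_space \<alpha> p" and p: "0 < p" and \<alpha>: "0 < \<alpha>" "\<alpha> < 1"
  shows "shift f \<in> weighted_space \<alpha> p"
    "energy \<alpha> p (shift f) = energy \<alpha> p f + (LBINT s:{0<..<1}. integral_mean p f s * gain \<alpha> p s)"
proof -
  let ?b = radius_seq and ?M = "integral_mean p f"
  let ?I = "LBINT s:{0<..<1}. ?M s * gain \<alpha> p s"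
  have hol: "f holomorphic_on ball 0 1" using f by (simp add: weighted_space_def)
  then have hol': "shift f holomorphic_on ball 0 1"
    unfolding shift_def by (intro holomorphic_intros)
  have bound: "?M s \<le> energy \<alpha> p f" if "0 \<le> s" "s < 1" for s
    using integral_mean_le_energy[OF f p \<alpha>(2) that] .
  have "(\<lambda>n. ?M (?b n) * ((1 - ?b n powr p) * weight \<alpha> (?b n))) \<longlonglongrightarrow> 0"
  proof (rule tendsto_0_le[OF boundary_term_LIMSEQ[OF \<alpha>(1) p], of _ "energy \<alpha> p f"])
    show "\<forall>\<^sub>F n in sequentially. norm (?M (?b n) * ((1 - ?b n powr p) * weight \<alpha> (?b n)))
        \<le> norm ((1 - ?b n powr p) * weight \<alpha> (?b n)) * energy \<alpha> p f"
    proof (intro always_eventually allI)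
      fix n
      have "?M (?b n) \<le> energy \<alpha> p f" using radius_seq_bounds[of n] by (intro bound) auto
      then show "norm (?M (?b n) * ((1 - ?b n powr p) * weight \<alpha> (?b n)))
        \<le> norm ((1 - ?b n powr p) * weight \<alpha> (?b n)) * energy \<alpha> p f"
        using mult_left_mono[of "?M (?b n)" "energy \<alpha> p f" "\<bar>(1 - ?b n powr p) * weight \<alpha> (?b n)\<bar>"]
        by (simp add: abs_mult integral_mean_nonneg mult.commute)
    qed
  qed
  moreover have "(\<lambda>n. integral {0..?b n} (\<lambda>s. ?M s * gain \<alpha> p s)) \<longlonglongrightarrow> ?I"
    using bound by (intro mean_gain_integral_LIMSEQ[OF hol p \<alpha>, of "energy \<alpha> p f"]) simp
  ultimately have "(\<lambda>n. partial_energy \<alpha> p f (?b n) + integral {0..?b n} (\<lambda>s. ?M s * gain \<alpha> p s)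
       - ?M (?b n) * ((1 - ?b n powr p) * weight \<alpha> (?b n))) \<longlonglongrightarrow> energy \<alpha> p f + ?I - 0"
    by (intro tendsto_diff tendsto_add partial_energy_LIMSEQ_energy f p \<alpha>)
  then have lim: "(\<lambda>n. partial_energy \<alpha> p (shift f) (?b n)) \<longlonglongrightarrow> energy \<alpha> p f + ?I"
    using radius_seq_bounds by (simp add: partial_energy_shift[OF hol p] less_imp_le)
  have "0 \<le> energy \<alpha> p f + ?I"
    using partial_energy_nonneg[OF hol' p _ _ \<alpha>(2)] radius_seq_bounds
    by (intro tendsto_lowerbound[OF lim always_eventually]) (auto simp: less_imp_le)
  from energy_eqI[OF hol' p this lim]
  show "shift f \<in> weighted_space \<alpha> p" "energy \<alpha> p (shift f) = energy \<alpha> p f + ?I" by auto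
qed

lemma constant_energy:
  assumes p: "0 < p" and c: "\<And>z. z \<in> ball 0 1 \<Longrightarrow> f z = c"
  shows "f \<in> weighted_space \<alpha> p" "energy \<alpha> p f = norm c powr p"
    "\<And>s. 0 \<le> s \<Longrightarrow> s < 1 \<Longrightarrow> integral_mean p f s = norm c powr p"
proof -
  have hol: "f holomorphic_on ball 0 1"
    using c by (subst holomorphic_cong[of _ _ _ "\<lambda>_. c"]) auto
  show M: "integral_mean p f s = norm c powr p" if "0 \<le> s" "s < 1" for s
    using c[OF polar_in_disc[OF that]] that by (simp add: integral_mean_eq[OF hol p])
  have "partial_energy \<alpha> p f b = norm c powr p" if b: "0 \<le> b" "b < 1" for b
  proof -
    have "integral {0..b} (\<lambda>s. integral_mean p f s * weight_deriv \<alpha> s) =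
        integral {0..b} (\<lambda>s. norm c powr p * weight_deriv \<alpha> s)"
      using b by (intro integral_cong) (simp add: M)
    also have "\<dots> = norm c powr p * (weight \<alpha> b - 1)"
      by (rule integral_unique[OF has_integral_mult_right[OF integral_weight_deriv[OF b]]])
    finally show ?thesis using b by (simp add: partial_energy_def M algebra_simps)
  qed
  then have "(\<lambda>n. partial_energy \<alpha> p f (radius_seq n)) \<longlonglongrightarrow> norm c powr p"
    using radius_seq_bounds by (simp add: less_imp_le)
  from energy_eqI[OF hol p _ this]
  show "f \<in> weighted_space \<alpha> p" "energy \<alpha> p f = norm c powr p" by auto
qed

section \<open>The norm of the shift and the case of equality\<close>

text \<open>
  Upper bound, positivity and case of equality for the increase. The upper bound holds because the
  integral mean is at most the \<open>p\<close>-th power of the norm.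
\<close>

lemma mean_gain_integral_bounds:
  assumes f: "f \<in> weighted_space \<alpha> p" and p: "0 < p" and \<alpha>: "0 < \<alpha>" "\<alpha> < 1"
  shows "(LBINT s:{0<..<1}. integral_mean p f s * gain \<alpha> p s) \<le> energy \<alpha> p f * (LBINT s:{0<..<1}. gain \<alpha> p s)"
    and "nonzero_on_disc f \<Longrightarrow> 0 < (LBINT s:{0<..<1}. integral_mean p f s * gain \<alpha> p s)"
    and "energy \<alpha> p f = 1 \<Longrightarrow>
      (LBINT s:{0<..<1}. integral_mean p f s * gain \<alpha> p s) = (LBINT s:{0<..<1}. gain \<alpha> p s)
      \<longleftrightarrow> f constant_on ball 0 1"
proof -
  let ?M = "integral_mean p f" and ?E = "energy \<alpha> p f"
  have hol: "f holomorphic_on ball 0 1" using f by (simp add: weighted_space_def)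
  have bound: "?M s \<le> ?E" if "s \<in> {0<..<1}" for s
    using integral_mean_le_energy[OF f p \<alpha>(2), of s] that by simp
  have contM: "continuous_on {0<..<1} ?M"
    by (rule continuous_on_subset[OF integral_mean_continuous[OF hol p]]) auto
  have intM: "set_integrable lborel {0<..<1} (\<lambda>s. ?M s * gain \<alpha> p s)"
    using bound integral_mean_nonneg[of p f]
    by (intro set_integrable_mult_gain[OF \<alpha> p contM]) auto
  have intE: "set_integrable lborel {0<..<1} (\<lambda>s. ?E * gain \<alpha> p s)"
    using set_integrable_gain[OF \<alpha> p] by simp
  have "(LBINT s:{0<..<1}. ?M s * gain \<alpha> p s) \<le> (LBINT s:{0<..<1}. ?E * gain \<alpha> p s)"
    using bound gain_nonneg[OF \<alpha>(2) p] by (intro set_integral_mono intM intE mult_right_mono) auto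
  then show "(LBINT s:{0<..<1}. ?M s * gain \<alpha> p s) \<le> ?E * (LBINT s:{0<..<1}. gain \<alpha> p s)"
    by simp
  show "0 < (LBINT s:{0<..<1}. ?M s * gain \<alpha> p s)" if nz: "nonzero_on_disc f"
  proof (rule ccontr)
    assume "\<not> 0 < (LBINT s:{0<..<1}. ?M s * gain \<alpha> p s)"
    then have M0: "?M s = 0" if "s \<in> {0<..<1}" for s
      using that bound integral_mean_nonneg[of p f]
      by (intro gain_integral_eq_0_imp[OF \<alpha> p contM, of ?E]) auto
    obtain z where z: "norm z < 1" "f z \<noteq> 0" using nz by (auto simp: nonzero_on_disc_def)
    \<comment> \<open>a radius in the open interval, as \<open>z\<close> may be 0\<close>
    define r where "r = (1 + norm z) / 2"
    have r: "norm z \<le> r" "r \<in> {0<..<1}" using z(1) norm_ge_zero[of z] unfolding r_def by (auto intro: add_pos_nonneg)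
    have "?M (norm z) \<le> ?M r"
      using r z(1) by (intro mono_onD[OF integral_mean_mono_on[OF hol p]]) auto
    then have "?M (norm z) = 0" using M0[OF r(2)] integral_mean_nonneg[of p f "norm z"] by simp
    then show False using integral_mean_eq_0_imp[OF hol p z(1)] z(2) by simp
  qed
  show "(LBINT s:{0<..<1}. ?M s * gain \<alpha> p s) = (LBINT s:{0<..<1}. gain \<alpha> p s) \<longleftrightarrow> f constant_on ball 0 1"
    if E1: "?E = 1"
  proof
    assume eq: "(LBINT s:{0<..<1}. ?M s * gain \<alpha> p s) = (LBINT s:{0<..<1}. gain \<alpha> p s)"
    have "(LBINT s:{0<..<1}. (1 - ?M s) * gain \<alpha> p s) =
        (LBINT s:{0<..<1}. gain \<alpha> p s) - (LBINT s:{0<..<1}. ?M s * gain \<alpha> p s)"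
      using set_integral_diff(2)[OF set_integrable_gain[OF \<alpha> p] intM] by (simp add: left_diff_distrib)
    then have zero: "(LBINT s:{0<..<1}. (1 - ?M s) * gain \<alpha> p s) \<le> 0" using eq by simp
    have "1 - ?M s = 0" if "s \<in> {0<..<1}" for s
      using bound E1 integral_mean_nonneg[of p f] that
      by (intro gain_integral_eq_0_imp[OF \<alpha> p _ _ _ zero, of 1] continuous_on_diff continuous_on_const contM) auto
    then have M1: "?M s = 1" if "s \<in> {0<..<1}" for s using that by force
    \<comment> \<open>the mean at 0 is a limit of means over positive radii\<close>
    have "?M 0 = 1"
    proof (rule tendsto_unique)
      have "(0::real) islimpt {0..<1}"
        by (rule islimpt_subset[OF islimpt_greaterThanLessThan1[of 0 "1::real"]]) auto
      then show "at (0::real) within {0..<1} \<noteq> bot"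
        by (simp add: trivial_limit_within)
      show "(?M \<longlongrightarrow> ?M 0) (at 0 within {0..<1})"
        using integral_mean_continuous[OF hol p] unfolding continuous_on_def by simp
      have "\<forall>\<^sub>F s in at 0 within {0..<1}. ?M s = 1"
        using M1 by (simp add: eventually_at_filter)
      then show "(?M \<longlongrightarrow> 1) (at 0 within {0..<1})"
        by (rule tendsto_eventually)
    qed
    then show "f constant_on ball 0 1"
      using M1 integral_mean_0[OF hol p] by (intro integral_mean_constant_imp[OF hol p]) auto
  next
    assume "f constant_on ball 0 1"
    then obtain c where c: "\<And>z. z \<in> ball 0 1 \<Longrightarrow> f z = c" by (auto simp: constant_on_def)
    have "?M s = 1" if "s \<in> {0<..<1}" for s
      using constant_energy(2)[where \<alpha>=\<alpha>, OF p c] constant_energy(3)[where s=s, OF p c] E1 that by simp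
    then show "(LBINT s:{0<..<1}. ?M s * gain \<alpha> p s) = (LBINT s:{0<..<1}. gain \<alpha> p s)"
      by (intro set_lebesgue_integral_cong) auto
  qed
qed

theorem theorem1p7:
  fixes \<alpha> p :: real
  assumes "0 < \<alpha>" and "\<alpha> < 1" and "0 < p"
  shows "strict_expansion \<alpha> p shift \<and>
    norm_attaining \<alpha> p shift \<and>
    operator_norm \<alpha> p shift < \<infinity> \<and>
    enn2real (operator_norm \<alpha> p shift) powr p =
      1 + 2 * (1 - \<alpha>) *
        (LBINT r:{0<..<1}. (1 - r powr p) * (1 - r\<^sup>2) powr (\<alpha> - 2) * r) \<and>
    (\<forall>f0\<in>weighted_space \<alpha> p. weighted_norm \<alpha> p f0 = 1 \<longrightarrow>
       (ennreal (weighted_norm \<alpha> p (shift f0)) = operator_norm \<alpha> p shift \<longleftrightarrow>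
        f0 constant_on ball 0 1))"
proof -
  note \<alpha> = assms(1,2) and p = assms(3)
  define K where "K = (LBINT s:{0<..<1}. gain \<alpha> p s)"
  \<comment> \<open>the integral in the statement is the total mass of \<open>gain\<close>\<close>
  have K_eq: "K = 2 * (1 - \<alpha>) * (LBINT r:{0<..<1}. (1 - r powr p) * (1 - r\<^sup>2) powr (\<alpha> - 2) * r)"
    unfolding K_def set_integral_mult_right[symmetric] gain_def weight_deriv_def
    by (intro set_lebesgue_integral_cong) (auto simp: algebra_simps)
  have "0 \<le> K"
    unfolding K_def set_lebesgue_integral_def
    using gain_nonneg[OF \<alpha>(2) p] by (intro integral_nonneg_AE AE_I2) (auto simp: indicator_def)
  have root: "(x powr (1 / p)) powr p = x" if "0 \<le> x" for x :: real
    using that p by (simp add: powr_powr)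
  have energy1: "energy \<alpha> p f = 1" if "weighted_norm \<alpha> p f = 1" for f
    using root[OF energy_nonneg[of \<alpha> p f]] that by (simp add: weighted_norm_eq)
  have shift_le: "energy \<alpha> p (shift f) \<le> (1 + K) * energy \<alpha> p f" if "f \<in> weighted_space \<alpha> p" for f
    using shift_energy(2)[OF that p \<alpha>] mean_gain_integral_bounds(1)[OF that p \<alpha>]
    by (simp add: K_def algebra_simps)
  have shift_gt: "energy \<alpha> p f < energy \<alpha> p (shift f)"
    if "f \<in> weighted_space \<alpha> p" "nonzero_on_disc f" for f
    using shift_energy(2)[OF that(1) p \<alpha>] mean_gain_integral_bounds(2)[OF that(1) p \<alpha> that(2)] by simp
  have shift_eq: "energy \<alpha> p (shift f) = 1 + K \<longleftrightarrow> f constant_on ball 0 1"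
    if "f \<in> weighted_space \<alpha> p" "energy \<alpha> p f = 1" for f
    using shift_energy(2)[OF that(1) p \<alpha>] mean_gain_integral_bounds(3)[OF that(1) p \<alpha> that(2)] that(2)
    by (simp add: K_def)

  \<comment> \<open>the constant function 1 attains the norm\<close>
  define one :: "complex \<Rightarrow> complex" where "one = (\<lambda>_. 1)"
  have one: "one \<in> weighted_space \<alpha> p" "energy \<alpha> p one = 1"
    using constant_energy(1,2)[OF p, of one 1 \<alpha>] by (simp_all add: one_def)
  have one_nz: "nonzero_on_disc one" by (auto simp: nonzero_on_disc_def one_def intro!: exI[of _ 0])
  have one_shift: "energy \<alpha> p (shift one) = 1 + K"
    using shift_eq[OF one] by (simp add: one_def constant_on_def)
  have norm_one: "weighted_norm \<alpha> p one = 1" "weighted_norm \<alpha> p (shift one) = (1 + K) powr (1 / p)"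
    by (simp_all add: weighted_norm_eq one one_shift)

  have op: "operator_norm \<alpha> p shift = ennreal ((1 + K) powr (1 / p))"
    unfolding operator_norm_def
  proof (rule antisym)
    show "(SUP f\<in>{f \<in> weighted_space \<alpha> p. nonzero_on_disc f}.
        ennreal (weighted_norm \<alpha> p (shift f) / weighted_norm \<alpha> p f)) \<le> ennreal ((1 + K) powr (1 / p))"
    proof (rule SUP_least)
      fix f assume f: "f \<in> {f \<in> weighted_space \<alpha> p. nonzero_on_disc f}"
      then have "energy \<alpha> p f \<noteq> 0"
        using shift_le[of f] shift_gt[of f] by auto
      then have pos: "0 < energy \<alpha> p f" using energy_nonneg[of \<alpha> p f] by simp
      have "energy \<alpha> p (shift f) / energy \<alpha> p f \<le> 1 + K"
        using shift_le[of f] f pos by (simp add: field_simps)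
      then have "(energy \<alpha> p (shift f) / energy \<alpha> p f) powr (1 / p) \<le> (1 + K) powr (1 / p)"
        using p pos energy_nonneg[of \<alpha> p "shift f"] by (intro powr_mono2) auto
      then show "ennreal (weighted_norm \<alpha> p (shift f) / weighted_norm \<alpha> p f) \<le> ennreal ((1 + K) powr (1 / p))"
        using pos energy_nonneg by (intro ennreal_leI) (simp add: weighted_norm_eq powr_divide)
    qed
    have "ennreal (weighted_norm \<alpha> p (shift one) / weighted_norm \<alpha> p one) \<le>
      (SUP f\<in>{f \<in> weighted_space \<alpha> p. nonzero_on_disc f}.
        ennreal (weighted_norm \<alpha> p (shift f) / weighted_norm \<alpha> p f))"
      using one one_nz by (intro SUP_upper) simp
    then show "ennreal ((1 + K) powr (1 / p)) \<le>
      (SUP f\<in>{f \<in> weighted_space \<alpha> p. nonzero_on_disc f}.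
        ennreal (weighted_norm \<alpha> p (shift f) / weighted_norm \<alpha> p f))"
      by (simp add: norm_one)
  qed

  have "strict_expansion \<alpha> p shift"
    unfolding strict_expansion_def weighted_norm_eq
    using shift_energy(1)[OF _ p \<alpha>] shift_gt p energy_nonneg
    by (auto intro!: powr_less_mono2)
  moreover have "norm_attaining \<alpha> p shift"
    unfolding norm_attaining_def op using one norm_one by (intro bexI[of _ one]) auto
  moreover have "enn2real (operator_norm \<alpha> p shift) powr p = 1 + K"
    using root[of "1 + K"] \<open>0 \<le> K\<close> by (simp add: op)
  moreover have "ennreal (weighted_norm \<alpha> p (shift f)) = operator_norm \<alpha> p shift \<longleftrightarrow> f constant_on ball 0 1"
    if f: "f \<in> weighted_space \<alpha> p" "weighted_norm \<alpha> p f = 1" for f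
  proof -
    have "ennreal (weighted_norm \<alpha> p (shift f)) = operator_norm \<alpha> p shift \<longleftrightarrow>
        energy \<alpha> p (shift f) powr (1 / p) = (1 + K) powr (1 / p)"
      by (simp add: op weighted_norm_eq)
    also have "\<dots> \<longleftrightarrow> energy \<alpha> p (shift f) = 1 + K"
      using root[of "1 + K"] root[OF energy_nonneg[of \<alpha> p "shift f"]] \<open>0 \<le> K\<close> by (metis add_nonneg_nonneg zero_le_one)
    also have "\<dots> \<longleftrightarrow> f constant_on ball 0 1" by (rule shift_eq[OF f(1) energy1[OF f(2)]])
    finally show ?thesis .
  qed
  ultimately show ?thesis by (simp add: op K_eq)
qed

end
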